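(* Let $\mathsf{CIdDLM}$ be the variety of commutative idempotent distributive $\ell$-monoids, and let the algebras $\mathbf{C}_n,\mathbf{C}_n^\partial$ and the equations $\sigma_n,\sigma_n^\partial,\gamma_n$ be as defined in the context. (1) If $n\ge 2$ is even, then the equations $\sigma_n$ and $\sigma_n^\partial$ axiomatize the subvarieties $V(\mathbf{C}_n)$ and $V(\mathbf{C}_n^\partial)$, respectively, relative to $\mathsf{CIdDLM}$. (2) If $n\ge 2$ is odd, then the equations $\sigma_n$ and $\sigma_n^\partial$ axiomatize the subvarieties $V(\mathbf{C}_n^\partial)$ and $V(\mathbf{C}_n)$, respectively, relative to $\mathsf{CIdDLM}$. (3) For $n\ge 2$ the equation $\gamma_{n+1}$ axiomatizes the subvariety $V(\mathbf{C}_n,\mathbf{C}_n^\partial)$ relative to $\mathsf{CIdDLM}$.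
   Context: A distributive $\ell$-monoid is an algebra $\mathbf{M}=\langle M,\wedge,\vee,\cdot,e\rangle$ such that $\langle M,\wedge,\vee\rangle$ is a distributive lattice, $\langle M,\cdot,e\rangle$ is a monoid, and $a(b\vee c)d=abd\vee acd$, $a(b\wedge c)d=abd\wedge acd$ for all $a,b,c,d\in M$. It is commutative (idempotent) if its monoid operation is commutative (satisfies $x^2\approx x$). An ordered monoid is a distributive $\ell$-monoid whose lattice order is total. $V(\mathcal{K})$ denotes the variety generated by $\mathcal{K}$. An equation axiomatizes a subvariety $\mathsf{W}$ relative to a variety $\mathsf{V}$ if $\mathsf{W}$ consists of exactly the members of $\mathsf{V}$ satisfying it. $\mathbf{C}_2$ is the idempotent ordered monoid with universe $\{\bot<e\}$ and identity $e$; $\mathbf{C}_2^\partial$ is the idempotent ordered monoid with universe $\{e<\top\}$ and identity $e$. For idempotent ordered monoids $\mathbf{M},\mathbf{N}$, relabeled so that $M\cap N=\{e\}$, the nested sum $\mathbf{M}\boxplus\mathbf{N}$ has universe $M\cup N$ and identity $e$; its product extends those of $\mathbf{M}$ and $\mathbf{N}$, with $a\cdot b=b\cdot a=a$ for all $a\in M\setminus\{e\}$, $b\in N$; its order is the least extension of the orders of $\mathbf{M}$ and $\mathbf{N}$ such that for all $a\in M\setminus\{e\}$, $b\in N$: $a\le b$ if $a\le_{\mathbf{M}}e$, and $b\le a$ if $e\le_{\mathbf{M}}a$. For $n>2$ define inductively $\mathbf{C}_n=\mathbf{C}_2\boxplus\mathbf{C}_{n-1}^\partial$ and $\mathbf{C}_n^\partial=\mathbf{C}_2^\partial\boxplus\mathbf{C}_{n-1}$.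 For terms $s,t$, $s\le t$ denotes the equation $s\wedge t\approx s$. The equations $\sigma_n=(s_n\le t_n)$ in the variables $x_1,\dots,x_{n-1}$, for $n\ge 2$, are defined inductively: $\sigma_2$ is $x_1\le e$ (so $s_2=x_1$, $t_2=e$); given $\sigma_n=(s_n\le t_n)$, $\sigma_{n+1}$ is $s_n\wedge x_{n-1}x_n\le t_n$ if $n+1$ is even, and $s_n\le t_n\vee x_{n-1}x_n$ if $n+1$ is odd. For a term $t$, let $t^\partial$ be obtained by interchanging $\wedge$ and $\vee$ (leaving variables, products and $e$ unchanged) and, in addition, replacing each variable $x_k$ by $y_k$, where $\{y_1,\dots,y_{n-1}\}$ is a set of distinct variables disjoint from $\{x_1,\dots,x_{n-1}\}$. Then $\sigma_n^\partial$ is the equation $t_n^\partial\le s_n^\partial$, and $\gamma_n$ is the equation $s_n\,t_n^\partial\le t_n\,s_n^\partial$. *)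

theory Defs
  imports "HOL-Algebra.Group" "HOL-Library.FuncSet"
begin

subsection \<open>Distributive l-monoids\<close>

record 'a lmonoid = "'a monoid" +
  lmeet :: "'a \<Rightarrow> 'a \<Rightarrow> 'a"  (infixl \<open>\<curlywedge>\<index>\<close> 70)
  ljoin :: "'a \<Rightarrow> 'a \<Rightarrow> 'a"  (infixl \<open>\<curlyvee>\<index>\<close> 65)

text \<open>Algebras in the signature of distributive l-monoids, no equations imposed.\<close>

locale lm_algebra =
  fixes M :: "'a lmonoid" (structure)
  assumes one_closed: "\<one> \<in> carrier M"
    and mult_closed: "\<lbrakk>a \<in> carrier M; b \<in> carrier M\<rbrakk> \<Longrightarrow> a \<otimes> b \<in> carrier M"
    and meet_closed: "\<lbrakk>a \<in> carrier M; b \<in> carrier M\<rbrakk> \<Longrightarrow> a \<curlywedge> b \<in> carrier M"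
    and join_closed: "\<lbrakk>a \<in> carrier M; b \<in> carrier M\<rbrakk> \<Longrightarrow> a \<curlyvee> b \<in> carrier M"

locale dist_lmonoid = lm_algebra M + monoid M
  for M :: "'a lmonoid" (structure) +
  assumes meet_comm: "\<lbrakk>a \<in> carrier M; b \<in> carrier M\<rbrakk> \<Longrightarrow> a \<curlywedge> b = b \<curlywedge> a"
    and join_comm: "\<lbrakk>a \<in> carrier M; b \<in> carrier M\<rbrakk> \<Longrightarrow> a \<curlyvee> b = b \<curlyvee> a"
    and meet_assoc: "\<lbrakk>a \<in> carrier M; b \<in> carrier M; c \<in> carrier M\<rbrakk>
          \<Longrightarrow> (a \<curlywedge> b) \<curlywedge> c = a \<curlywedge> (b \<curlywedge> c)"
    and join_assoc: "\<lbrakk>a \<in> carrier M; b \<in> carrier M; c \<in> carrier M\<rbrakk>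
          \<Longrightarrow> (a \<curlyvee> b) \<curlyvee> c = a \<curlyvee> (b \<curlyvee> c)"
    and meet_absorb: "\<lbrakk>a \<in> carrier M; b \<in> carrier M\<rbrakk> \<Longrightarrow> a \<curlywedge> (a \<curlyvee> b) = a"
    and join_absorb: "\<lbrakk>a \<in> carrier M; b \<in> carrier M\<rbrakk> \<Longrightarrow> a \<curlyvee> (a \<curlywedge> b) = a"
    and meet_join_distrib: "\<lbrakk>a \<in> carrier M; b \<in> carrier M; c \<in> carrier M\<rbrakk>
          \<Longrightarrow> a \<curlywedge> (b \<curlyvee> c) = (a \<curlywedge> b) \<curlyvee> (a \<curlywedge> c)"
    and mult_join_distrib:
      "\<lbrakk>a \<in> carrier M; b \<in> carrier M; c \<in> carrier M; d \<in> carrier M\<rbrakk>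
          \<Longrightarrow> a \<otimes> (b \<curlyvee> c) \<otimes> d = (a \<otimes> b \<otimes> d) \<curlyvee> (a \<otimes> c \<otimes> d)"
    and mult_meet_distrib:
      "\<lbrakk>a \<in> carrier M; b \<in> carrier M; c \<in> carrier M; d \<in> carrier M\<rbrakk>
          \<Longrightarrow> a \<otimes> (b \<curlywedge> c) \<otimes> d = (a \<otimes> b \<otimes> d) \<curlywedge> (a \<otimes> c \<otimes> d)"

locale comm_idem_dist_lmonoid = dist_lmonoid M + comm_monoid M
  for M :: "'a lmonoid" (structure) +
  assumes mult_idem: "a \<in> carrier M \<Longrightarrow> a \<otimes> a = a"

definition CIdDLM :: "'a lmonoid set" where
  "CIdDLM = {M. comm_idem_dist_lmonoid M}"

definition lle :: "'a lmonoid \<Rightarrow> 'a \<Rightarrow> 'a \<Rightarrow> bool" where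
  "lle M a b \<longleftrightarrow> a \<curlywedge>\<^bsub>M\<^esub> b = a"


subsection \<open>Terms and equations\<close>

datatype (vars: 'v) trm =
    Var 'v
  | One
  | Mult "'v trm" "'v trm"
  | Meet "'v trm" "'v trm"
  | Join "'v trm" "'v trm"

primrec eval :: "'a lmonoid \<Rightarrow> ('v \<Rightarrow> 'a) \<Rightarrow> 'v trm \<Rightarrow> 'a" where
  "eval M f (Var v) = f v"
| "eval M f One = \<one>\<^bsub>M\<^esub>"
| "eval M f (Mult s t) = eval M f s \<otimes>\<^bsub>M\<^esub> eval M f t"
| "eval M f (Meet s t) = eval M f s \<curlywedge>\<^bsub>M\<^esub> eval M f t"
| "eval M f (Join s t) = eval M f s \<curlyvee>\<^bsub>M\<^esub> eval M f t"

type_synonym 'v equation = "'v trm \<times> 'v trm"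

definition satisfies :: "'a lmonoid \<Rightarrow> 'v equation \<Rightarrow> bool" (infix \<open>\<Turnstile>\<close> 50) where
  "M \<Turnstile> q \<longleftrightarrow> (\<forall>f \<in> UNIV \<rightarrow> carrier M. eval M f (fst q) = eval M f (snd q))"

definition leq_eqn :: "'v trm \<Rightarrow> 'v trm \<Rightarrow> 'v equation" where
  "leq_eqn s t = (Meet s t, s)"

text \<open>The variables of all equations: \<open>X k\<close> stands for \<open>x\<^sub>k\<close> and \<open>Y k\<close> for \<open>y\<^sub>k\<close>.\<close>

datatype var = X nat | Y nat


subsection \<open>Generated varieties\<close>

text \<open>
  A variety is an equational class, the class of all algebras satisfying some set \<open>E\<close> of
  equations (over the countably infinite set of variables \<open>var\<close>). The variety generated by \<open>K\<close>
  is the least variety containing \<open>K\<close>, so \<open>M\<close> belongs to it iff \<open>M\<close> belongs to every variety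
  that contains \<open>K\<close>. As a class cannot range over all types, \<open>variety K\<close> denotes the part of the
  variety whose members have their carrier in a given type, which may differ from the type of
  the generators. The theorem \<open>variety_iff_HSP\<close> shows that this is the same as closing \<open>K\<close>
  under products, subalgebras and homomorphic images.
\<close>

definition variety :: "'b lmonoid set \<Rightarrow> 'a lmonoid set" where
  "variety K = {M. lm_algebra M \<and>
     (\<forall>E :: var equation set. (\<forall>A \<in> K. \<forall>q \<in> E. A \<Turnstile> q) \<longrightarrow> (\<forall>q \<in> E. M \<Turnstile> q))}"

definition axiomatizes_rel :: "'v equation \<Rightarrow> 'a lmonoid set \<Rightarrow> 'a lmonoid set \<Rightarrow> bool" where
  "axiomatizes_rel q W V \<longleftrightarrow> W = {M \<in> V. M \<Turnstile> q}"

definition product_alg :: "'i set \<Rightarrow> ('i \<Rightarrow> 'b lmonoid) \<Rightarrow> ('i \<Rightarrow> 'b) lmonoid" where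
  "product_alg I A =
     \<lparr>carrier = (\<Pi>\<^sub>E i\<in>I. carrier (A i)),
      mult = (\<lambda>f g. \<lambda>i\<in>I. f i \<otimes>\<^bsub>A i\<^esub> g i),
      one = (\<lambda>i\<in>I. \<one>\<^bsub>A i\<^esub>),
      lmeet = (\<lambda>f g. \<lambda>i\<in>I. f i \<curlywedge>\<^bsub>A i\<^esub> g i),
      ljoin = (\<lambda>f g. \<lambda>i\<in>I. f i \<curlyvee>\<^bsub>A i\<^esub> g i)\<rparr>"

definition subuniverse :: "'a set \<Rightarrow> 'a lmonoid \<Rightarrow> bool" where
  "subuniverse S A \<longleftrightarrow> S \<subseteq> carrier A \<and> lm_algebra (A\<lparr>carrier := S\<rparr>)"

definition surj_lm_hom :: "('a \<Rightarrow> 'b) \<Rightarrow> 'a lmonoid \<Rightarrow> 'b lmonoid \<Rightarrow> bool" where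
  "surj_lm_hom h A B \<longleftrightarrow> h ` carrier A = carrier B \<and> h \<one>\<^bsub>A\<^esub> = \<one>\<^bsub>B\<^esub> \<and>
     (\<forall>a \<in> carrier A. \<forall>b \<in> carrier A.
        h (a \<otimes>\<^bsub>A\<^esub> b) = h a \<otimes>\<^bsub>B\<^esub> h b \<and>
        h (a \<curlywedge>\<^bsub>A\<^esub> b) = h a \<curlywedge>\<^bsub>B\<^esub> h b \<and>
        h (a \<curlyvee>\<^bsub>A\<^esub> b) = h a \<curlyvee>\<^bsub>B\<^esub> h b)"

lemma eval_closed:
  assumes "lm_algebra M" "\<And>v. v \<in> vars t \<Longrightarrow> f v \<in> carrier M"
  shows "eval M f t \<in> carrier M"
  using assms(2) by (induction t) (auto intro: lm_algebra.one_closed[OF assms(1)]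
      lm_algebra.mult_closed[OF assms(1)] lm_algebra.meet_closed[OF assms(1)]
      lm_algebra.join_closed[OF assms(1)])

lemma eval_cong: "(\<And>v. v \<in> vars t \<Longrightarrow> f v = g v) \<Longrightarrow> eval M f t = eval M g t"
  by (induction t) auto

lemma eval_map_trm: "eval M f (map_trm g t) = eval M (f \<circ> g) t"
  by (induction t) auto

lemma eval_carrier_update: "eval (A\<lparr>carrier := S\<rparr>) f t = eval A f t"
  by (induction t) auto

lemma eval_hom:
  assumes A: "lm_algebra A" and h: "surj_lm_hom h A B"
    and "\<And>v. v \<in> vars t \<Longrightarrow> f v \<in> carrier A"
  shows "h (eval A f t) = eval B (h \<circ> f) t"
proof -
  have "(\<forall>v \<in> vars t. f v \<in> carrier A) \<longrightarrow> h (eval A f t) = eval B (h \<circ> f) t"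
    using h eval_closed[OF A, of _ f] by (induction t) (auto simp: surj_lm_hom_def)
  then show ?thesis using assms(3) by blast
qed

lemma eval_product:
  assumes "i \<in> I" shows "eval (product_alg I A) f t i = eval (A i) (\<lambda>v. f v i) t"
  using assms by (induction t) (auto simp: product_alg_def)

lemma infinite_var: "infinite (UNIV :: var set)"
proof -
  have "inj X" by (auto simp: inj_def)
  then show ?thesis using finite_subset[of "range X" UNIV] finite_imageD by blast
qed

lemma finite_vars: "finite (vars t)"
  by (induction t) auto

lemma HSP_imp_variety:
  fixes I :: "'i set" and K :: "'b lmonoid set" and M :: "'a lmonoid"
  assumes M: "lm_algebra M" and A: "\<And>i. i \<in> I \<Longrightarrow> A i \<in> K"
    and S: "subuniverse S (product_alg I A)"
    and h: "surj_lm_hom h ((product_alg I A)\<lparr>carrier := S\<rparr>) M"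
  shows "M \<in> variety K"
proof -
  let ?P = "product_alg I A" let ?S = "?P\<lparr>carrier := S\<rparr>"
  have algS: "lm_algebra ?S" and SP: "S \<subseteq> (\<Pi>\<^sub>E i\<in>I. carrier (A i))"
    using S by (auto simp: subuniverse_def product_alg_def)
  have "M \<Turnstile> (s, t)" if K: "\<forall>A \<in> K. A \<Turnstile> (s, t)" for s t :: "var trm"
    unfolding satisfies_def
  proof
    fix f :: "var \<Rightarrow> 'a" assume f: "f \<in> UNIV \<rightarrow> carrier M"
    have "\<exists>a. a \<in> S \<and> h a = f v" for v
    proof -
      have "f v \<in> h ` S" using f h by (auto simp: surj_lm_hom_def)
      then show ?thesis by auto
    qed
    then obtain g where g: "\<And>v. g v \<in> S" "\<And>v. h (g v) = f v" by metis
    have hg: "h \<circ> g = f" using g by auto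
    have ev: "eval ?P g u \<in> S" for u
      using eval_closed[OF algS, of u g] g by (simp add: eval_carrier_update)
    have "eval ?P g s = eval ?P g t"
    proof (rule PiE_ext)
      show "eval ?P g s \<in> (\<Pi>\<^sub>E i\<in>I. carrier (A i))" "eval ?P g t \<in> (\<Pi>\<^sub>E i\<in>I. carrier (A i))"
        using ev SP by auto
      fix i assume i: "i \<in> I"
      have "(\<lambda>v. g v i) \<in> UNIV \<rightarrow> carrier (A i)" using g SP i by (auto simp: PiE_def Pi_def)
      then show "eval ?P g s i = eval ?P g t i"
        using K A[OF i] by (auto simp: eval_product[OF i] satisfies_def)
    qed
    moreover have "h (eval ?P g u) = eval M f u" for u
      using eval_hom[OF algS h, of u g] g hg by (simp add: eval_carrier_update)
    ultimately show "eval M f (fst (s, t)) = eval M f (snd (s, t))" by (metis fst_conv snd_conv)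
  qed
  then show ?thesis using M by (auto simp: variety_def)
qed

text \<open>The index type on the right is large enough for every product that is needed; by
  \<open>HSP_imp_variety\<close> no larger index type yields further algebras.\<close>

theorem variety_iff_HSP:
  fixes K :: "'b lmonoid set" and M :: "'a lmonoid"
  assumes K: "\<And>A. A \<in> K \<Longrightarrow> lm_algebra A" and M: "lm_algebra M"
  shows "M \<in> variety K \<longleftrightarrow>
    (\<exists>(I :: ('b lmonoid \<times> ('a \<Rightarrow> 'b)) set) A S h. (\<forall>i\<in>I. A i \<in> K) \<and>
       subuniverse S (product_alg I A) \<and> surj_lm_hom h ((product_alg I A)\<lparr>carrier := S\<rparr>) M)"
    (is "_ \<longleftrightarrow> ?HSP")
proof
  assume "?HSP"
  then obtain I :: "('b lmonoid \<times> ('a \<Rightarrow> 'b)) set" and A S h where "\<forall>i\<in>I. A i \<in> K"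
    "subuniverse S (product_alg I A)" "surj_lm_hom h ((product_alg I A)\<lparr>carrier := S\<rparr>) M"
    by blast
  then show "M \<in> variety K" using HSP_imp_variety[OF M, of I A K S h] by blast
next
  assume V: "M \<in> variety K"
  define I :: "('b lmonoid \<times> ('a \<Rightarrow> 'b)) set" where
    "I = {(A, f). A \<in> K \<and> f \<in> UNIV \<rightarrow> carrier A}"
  define T where "T = {t :: 'a trm. vars t \<subseteq> carrier M}"
  define \<pi> where "\<pi> = (\<lambda>t :: 'a trm. \<lambda>i\<in>I. eval (fst i) (snd i) t)"
  let ?P = "product_alg I fst" let ?S = "?P\<lparr>carrier := \<pi> ` T\<rparr>"
  define h where "h = (\<lambda>p. eval M id (SOME t. t \<in> T \<and> \<pi> t = p))"
  have eq: "eval M id s = eval M id t" if s: "s \<in> T" and t: "t \<in> T" and st: "\<pi> s = \<pi> t" for s t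
  proof -
    have "finite (vars s \<union> vars t)" by (simp add: finite_vars)
    then obtain g :: "'a \<Rightarrow> var" where g: "inj_on g (vars s \<union> vars t)"
      using infinite_arbitrarily_large[OF infinite_var, of "card (vars s \<union> vars t)"]
        finite_same_card_bij bij_betw_imp_inj_on by metis
    have "A \<Turnstile> (map_trm g s, map_trm g t)" if A: "A \<in> K" for A
      unfolding satisfies_def
    proof
      fix f :: "var \<Rightarrow> 'b" assume "f \<in> UNIV \<rightarrow> carrier A"
      then have i: "(A, f \<circ> g) \<in> I" using A by (auto simp: I_def)
      have "\<pi> s (A, f \<circ> g) = \<pi> t (A, f \<circ> g)" using st by simp
      then show "eval A f (fst (map_trm g s, map_trm g t)) = eval A f (snd (map_trm g s, map_trm g t))"
        using i by (simp add: \<pi>_def eval_map_trm)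
    qed
    then have "M \<Turnstile> (map_trm g s, map_trm g t)"
      using V unfolding variety_def by blast
    moreover define f :: "var \<Rightarrow> 'a" where
      "f = (\<lambda>v. if v \<in> g ` (vars s \<union> vars t) then inv_into (vars s \<union> vars t) g v else \<one>\<^bsub>M\<^esub>)"
    have fg: "f (g x) = x" if "x \<in> vars s \<union> vars t" for x
      using that g by (simp add: f_def inv_into_f_f)
    have "f v \<in> carrier M" for v
    proof (cases "v \<in> g ` (vars s \<union> vars t)")
      case True
      then obtain x where x: "x \<in> vars s \<union> vars t" "v = g x" by blast
      then show ?thesis using fg[of x] s t by (auto simp: T_def)
    next
      case False
      then show ?thesis using M by (simp add: f_def lm_algebra.one_closed)
    qed
    ultimately have "eval M f (map_trm g s) = eval M f (map_trm g t)"
      by (auto simp: satisfies_def)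
    moreover have "eval M f (map_trm g s) = eval M id s" "eval M f (map_trm g t) = eval M id t"
      unfolding eval_map_trm by (auto intro!: eval_cong simp: fg)
    ultimately show ?thesis by simp
  qed
  have h: "h (\<pi> t) = eval M id t" if "t \<in> T" for t
  proof -
    let ?u = "SOME u. u \<in> T \<and> \<pi> u = \<pi> t"
    have "?u \<in> T \<and> \<pi> ?u = \<pi> t" by (rule someI[of _ t]) (use that in simp)
    then show ?thesis using eq that unfolding h_def by blast
  qed
  have closT: "One \<in> T" "\<And>s t. s \<in> T \<Longrightarrow> t \<in> T \<Longrightarrow> Mult s t \<in> T \<and> Meet s t \<in> T \<and> Join s t \<in> T"
    by (auto simp: T_def)
  have ops: "\<one>\<^bsub>?P\<^esub> = \<pi> One" "\<And>s t. \<pi> s \<otimes>\<^bsub>?P\<^esub> \<pi> t = \<pi> (Mult s t)"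
    "\<And>s t. \<pi> s \<curlywedge>\<^bsub>?P\<^esub> \<pi> t = \<pi> (Meet s t)" "\<And>s t. \<pi> s \<curlyvee>\<^bsub>?P\<^esub> \<pi> t = \<pi> (Join s t)"
    by (auto simp: product_alg_def \<pi>_def)
  have "\<pi> t \<in> carrier ?P" for t
    by (auto simp: \<pi>_def product_alg_def I_def intro!: eval_closed K)
  then have "subuniverse (\<pi> ` T) ?P"
    using closT by (auto simp: subuniverse_def lm_algebra_def ops)
  moreover have "surj_lm_hom h ?S M"
    unfolding surj_lm_hom_def
  proof (intro conjI ballI)
    have "h (\<pi> t) \<in> carrier M" if "t \<in> T" for t
      using that by (auto simp: h T_def intro!: eval_closed[OF M])
    moreover have "x \<in> h ` \<pi> ` T" if "x \<in> carrier M" for x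
    proof -
      have "Var x \<in> T" using that by (simp add: T_def)
      moreover from this have "h (\<pi> (Var x)) = x" by (simp add: h)
      ultimately show ?thesis by (metis imageI)
    qed
    ultimately show "h ` carrier ?S = carrier M" by auto
  qed (use closT in \<open>auto simp: ops h\<close>)
  moreover have "\<forall>i\<in>I. fst i \<in> K" by (auto simp: I_def)
  ultimately show ?HSP by blast
qed


subsection \<open>Nested sums and the chains\<close>

text \<open>The algebra with a totally ordered carrier given by its order relation.\<close>

definition ordered_alg ::
    "'a set \<Rightarrow> ('a \<Rightarrow> 'a \<Rightarrow> 'a) \<Rightarrow> 'a \<Rightarrow> ('a \<Rightarrow> 'a \<Rightarrow> bool) \<Rightarrow> 'a lmonoid" where
  "ordered_alg C m e r =
     \<lparr>carrier = C, mult = m, one = e,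
      lmeet = (\<lambda>a b. if r a b then a else b), ljoin = (\<lambda>a b. if r a b then b else a)\<rparr>"

text \<open>
  Only used when \<open>carrier M \<inter> carrier N = {\<one>\<^bsub>M\<^esub>}\<close> and \<open>\<one>\<^bsub>M\<^esub> = \<one>\<^bsub>N\<^esub>\<close>. The relation \<open>nested_le M N\<close>
  consists of the pairs that the order of the nested sum is required to contain; for ordered
  monoids \<open>M\<close> and \<open>N\<close> it is already a total order, hence the least extension.
\<close>

definition nested_le :: "'a lmonoid \<Rightarrow> 'a lmonoid \<Rightarrow> 'a \<Rightarrow> 'a \<Rightarrow> bool" where
  "nested_le M N a b \<longleftrightarrow>
     a \<in> carrier M \<and> b \<in> carrier M \<and> lle M a b \<or>
     a \<in> carrier N \<and> b \<in> carrier N \<and> lle N a b \<or>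
     a \<in> carrier M - {\<one>\<^bsub>M\<^esub>} \<and> b \<in> carrier N \<and> lle M a \<one>\<^bsub>M\<^esub> \<or>
     b \<in> carrier M - {\<one>\<^bsub>M\<^esub>} \<and> a \<in> carrier N \<and> lle M \<one>\<^bsub>M\<^esub> b"

definition nested_mult :: "'a lmonoid \<Rightarrow> 'a lmonoid \<Rightarrow> 'a \<Rightarrow> 'a \<Rightarrow> 'a" where
  "nested_mult M N a b =
     (if a \<in> carrier M \<and> b \<in> carrier M then a \<otimes>\<^bsub>M\<^esub> b
      else if a \<in> carrier N \<and> b \<in> carrier N then a \<otimes>\<^bsub>N\<^esub> b
      else if a \<in> carrier M then a else b)"

definition nested_sum :: "'a lmonoid \<Rightarrow> 'a lmonoid \<Rightarrow> 'a lmonoid" (infixr \<open>\<boxplus>\<close> 65) where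
  "M \<boxplus> N = ordered_alg (carrier M \<union> carrier N) (nested_mult M N) \<one>\<^bsub>M\<^esub> (nested_le M N)"

text \<open>
  \<open>C2 k\<close> and \<open>C2_dual k\<close> are copies of the two-element algebras with universe
  \<open>{\<bottom> < e}\<close> and \<open>{e < \<top>}\<close>. The label \<open>k\<close> does the relabeling needed for nested sums:
  all copies share \<open>E\<close> and copies with different labels share nothing else.
\<close>

datatype elt = E | Bot nat | Top nat

definition C2 :: "nat \<Rightarrow> elt lmonoid" where
  "C2 k = ordered_alg {Bot k, E} (\<lambda>a b. if a = E then b else a) E (\<lambda>a b. a = Bot k \<or> b = E)"

definition C2_dual :: "nat \<Rightarrow> elt lmonoid" where
  "C2_dual k = ordered_alg {E, Top k} (\<lambda>a b. if a = E then b else a) E (\<lambda>a b. a = E \<or> b = Top k)"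

text \<open>Meaningful for indices \<open>\<ge> 2\<close> only. The summand \<open>C_dual n\<close> uses labels \<open>\<le> n\<close>.\<close>

fun C :: "nat \<Rightarrow> elt lmonoid" and C_dual :: "nat \<Rightarrow> elt lmonoid" where
  "C 0 = C2 2"
| "C (Suc n) = (if n < 2 then C2 2 else C2 (Suc n) \<boxplus> C_dual n)"
| "C_dual 0 = C2_dual 2"
| "C_dual (Suc n) = (if n < 2 then C2_dual 2 else C2_dual (Suc n) \<boxplus> C n)"


subsection \<open>The equations\<close>

text \<open>As before, only the indices \<open>n \<ge> 2\<close> matter.\<close>

primrec s_trm :: "nat \<Rightarrow> var trm" where
  "s_trm 0 = Var (X 1)"
| "s_trm (Suc n) =
     (if n < 2 then Var (X 1)
      else if even (Suc n) then Meet (s_trm n) (Mult (Var (X (n - 1))) (Var (X n)))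
      else s_trm n)"

primrec t_trm :: "nat \<Rightarrow> var trm" where
  "t_trm 0 = One"
| "t_trm (Suc n) =
     (if n < 2 then One
      else if even (Suc n) then t_trm n
      else Join (t_trm n) (Mult (Var (X (n - 1))) (Var (X n))))"

text \<open>Besides interchanging meet and join, \<open>dual\<close> replaces \<open>x\<^sub>k\<close> by \<open>y\<^sub>k\<close>; it is only applied to
  terms in the variables \<open>x\<^sub>k\<close>.\<close>

primrec dual :: "var trm \<Rightarrow> var trm" where
  "dual (Var v) = Var (case v of X k \<Rightarrow> Y k | Y k \<Rightarrow> X k)"
| "dual One = One"
| "dual (Mult s t) = Mult (dual s) (dual t)"
| "dual (Meet s t) = Join (dual s) (dual t)"
| "dual (Join s t) = Meet (dual s) (dual t)"

definition \<sigma> :: "nat \<Rightarrow> var equation" where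
  "\<sigma> n = leq_eqn (s_trm n) (t_trm n)"

definition \<sigma>_dual :: "nat \<Rightarrow> var equation" where
  "\<sigma>_dual n = leq_eqn (dual (t_trm n)) (dual (s_trm n))"

definition \<gamma> :: "nat \<Rightarrow> var equation" where
  "\<gamma> n = leq_eqn (Mult (s_trm n) (dual (t_trm n))) (Mult (t_trm n) (dual (s_trm n)))"

end

theory Submission
  imports Defs
begin

text \<open>
  The proof reduces to ordered monoids. Given a prime ideal \<open>I\<close> of the lattice of a commutative
  distributive l-monoid, the residuals of \<open>I\<close> by the elements \<open>a\<close> are linearly ordered by inclusion,
  and mapping \<open>a\<close> to its residual is a homomorphism onto an ordered monoid (\<open>trace_hom\<close>,
  \<open>trace_total\<close>). As prime ideals separate elements, a member of \<open>CIdDLM\<close> satisfies an equation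
  as soon as all its totally ordered images do (\<open>CIdDLM_satisfies_if_chains_satisfy\<close>).

  A product of two elements of an idempotent commutative ordered monoid is one of its factors, which
  is said to absorb the other. An assignment refutes \<open>\<sigma> n\<close> in such a chain iff the values
  of \<open>x\<^sub>1, \<dots>, x\<^sub>n\<^sub>-\<^sub>1\<close> alternate between the two sides of the identity, beginning above it, and
  each value is absorbed by the next one (\<open>satisfies_sigma_iff\<close>). The algebras \<open>C n\<close> and \<open>C_dual n\<close>
  have the labels \<open>2, \<dots>, n\<close> on alternating sides, where higher labels absorb lower ones, which
  bounds the length of such sequences. Conversely, suppose that a chain satisfies \<open>\<sigma> n\<close>. The depth of
  an element is the greatest length of an alternating sequence that it absorbs; it is less than
  \<open>n - 1\<close>, does not decrease under absorption, and its parity is the side of the identity on which the element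
  lies. So the depth, shifted by 2, is a label, and this gives a homomorphism into \<open>C n\<close> or
  \<open>C_dual n\<close>, according to the parity of \<open>n\<close>. It may fail to be injective, but it remains a homomorphism
  after everything that does not absorb a given \<open>u\<close> has been collapsed to the identity. These
  homomorphisms separate all elements (\<open>level_map_separates\<close>), so the chain lies in the variety.

  The claims on \<open>\<sigma>_dual\<close> follow by reversing the order. Finally \<open>\<gamma> (n + 1)\<close> is equivalent to
  \<open>\<sigma> (n + 1)\<close> together with \<open>\<sigma>_dual (n + 1)\<close>, and an ordered monoid with both satisfies \<open>\<sigma> n\<close> or
  \<open>\<sigma>_dual n\<close> (\<open>satisfies_sigma_or_sigma_dual\<close>), so that it belongs to one of the two varieties.
\<close>

section \<open>Equations and homomorphic images\<close>

lemma satisfies_pairD: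
  "\<lbrakk>M \<Turnstile> (s, t); \<And>v. f v \<in> carrier M\<rbrakk> \<Longrightarrow> eval M f s = eval M f t"
  by (auto simp: satisfies_def)

lemma satisfies_hom_image:
  fixes q :: "'v equation" and A :: "'a lmonoid" and B :: "'b lmonoid"
  assumes A: "lm_algebra A" and h: "surj_lm_hom h A B" and q: "A \<Turnstile> q"
  shows "B \<Turnstile> q"
  unfolding satisfies_def
proof
  fix f :: "'v \<Rightarrow> 'b" assume f: "f \<in> UNIV \<rightarrow> carrier B"
  have "\<exists>a. a \<in> carrier A \<and> h a = f v" for v
  proof -
    have "f v \<in> h ` carrier A" using f h by (auto simp: surj_lm_hom_def)
    then show ?thesis by auto
  qed
  then obtain g where g: "\<And>v. g v \<in> carrier A" "\<And>v. h (g v) = f v" by metis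
  then have hg: "h \<circ> g = f" by auto
  have "eval A g (fst q) = eval A g (snd q)" using q g(1) by (auto simp: satisfies_def)
  moreover have "h (eval A g t) = eval B f t" for t :: "'v trm"
    using eval_hom[OF A h, of t g] g(1) hg by simp
  ultimately show "eval B f (fst q) = eval B f (snd q)" by metis
qed

lemma variety_mono: "K \<subseteq> L \<Longrightarrow> variety K \<subseteq> variety L"
  unfolding variety_def by blast

lemma varietyD: "\<lbrakk>M \<in> variety K; \<And>A. A \<in> K \<Longrightarrow> A \<Turnstile> q\<rbrakk> \<Longrightarrow> M \<Turnstile> (q :: var equation)"
  unfolding variety_def by blast

lemma varietyI:
  "\<lbrakk>lm_algebra M; \<And>q :: var equation. (\<And>A. A \<in> K \<Longrightarrow> A \<Turnstile> q) \<Longrightarrow> M \<Turnstile> q\<rbrakk> \<Longrightarrow> M \<in> variety K"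
  unfolding variety_def by blast

text \<open>All defining identities of \<open>CIdDLM\<close> are equations in at most four variables.\<close>

lemma CIdDLM_transfer:
  fixes M :: "'a lmonoid" and K :: "'b lmonoid set"
  assumes M: "lm_algebra M" and A: "\<And>A. A \<in> K \<Longrightarrow> A \<in> CIdDLM"
    and eqs: "\<And>q :: var equation. (\<And>A. A \<in> K \<Longrightarrow> A \<Turnstile> q) \<Longrightarrow> M \<Turnstile> q"
  shows "M \<in> CIdDLM"
proof -
  interpret lm_algebra M by (rule M)
  let ?a = "Var (X 0)" and ?b = "Var (X 1)" and ?c = "Var (X 2)" and ?d = "Var (X 3)"
  define val4 :: "'a \<Rightarrow> 'a \<Rightarrow> 'a \<Rightarrow> 'a \<Rightarrow> var \<Rightarrow> 'a" where
    "val4 = (\<lambda>a b c d v. if v = X 0 then a else if v = X 1 then b else if v = X 2 then c else d)"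
  have val4: "val4 a b c d (X 0) = a" "val4 a b c d (X 1) = b" "val4 a b c d (X 2) = c"
    "val4 a b c d (X 3) = d" for a b c d
    by (auto simp: val4_def)
  have rule: "eval M (val4 a b c d) s = eval M (val4 a b c d) t"
    if "\<And>(A :: 'b lmonoid) f. \<lbrakk>comm_idem_dist_lmonoid A; \<And>v. f v \<in> carrier A\<rbrakk> \<Longrightarrow> eval A f s = eval A f t"
      "a \<in> carrier M" "b \<in> carrier M" "c \<in> carrier M" "d \<in> carrier M" for s t a b c d
  proof (rule satisfies_pairD)
    show "M \<Turnstile> (s, t)"
    proof (rule eqs)
      fix A assume "A \<in> K"
      then have "comm_idem_dist_lmonoid A" using A by (simp add: CIdDLM_def)
      from that(1)[OF this] show "A \<Turnstile> (s, t)" unfolding satisfies_def fst_conv snd_conv by blast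
    qed
  qed (use that in \<open>auto simp: val4_def\<close>)
  note ax = comm_idem_dist_lmonoid.axioms dist_lmonoid.axioms comm_monoid.axioms
  note D = comm_idem_dist_lmonoid.axioms(1)
  have e: "\<one>\<^bsub>M\<^esub> \<in> carrier M" by (rule one_closed)
  show ?thesis unfolding CIdDLM_def mem_Collect_eq
  proof unfold_locales
    fix a b c assume abc: "a \<in> carrier M" "b \<in> carrier M" "c \<in> carrier M"
    show "a \<otimes>\<^bsub>M\<^esub> b \<otimes>\<^bsub>M\<^esub> c = a \<otimes>\<^bsub>M\<^esub> (b \<otimes>\<^bsub>M\<^esub> c)"
      using rule[OF _ abc e, of "Mult (Mult ?a ?b) ?c" "Mult ?a (Mult ?b ?c)"]
      by (simp add: val4[simplified] monoid.m_assoc ax)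
    show "a \<curlywedge>\<^bsub>M\<^esub> b \<curlywedge>\<^bsub>M\<^esub> c = a \<curlywedge>\<^bsub>M\<^esub> (b \<curlywedge>\<^bsub>M\<^esub> c)"
      using rule[OF _ abc e, of "Meet (Meet ?a ?b) ?c" "Meet ?a (Meet ?b ?c)"]
      by (simp add: val4[simplified] dist_lmonoid.meet_assoc D)
    show "a \<curlyvee>\<^bsub>M\<^esub> b \<curlyvee>\<^bsub>M\<^esub> c = a \<curlyvee>\<^bsub>M\<^esub> (b \<curlyvee>\<^bsub>M\<^esub> c)"
      using rule[OF _ abc e, of "Join (Join ?a ?b) ?c" "Join ?a (Join ?b ?c)"]
      by (simp add: val4[simplified] dist_lmonoid.join_assoc D)
    show "a \<curlywedge>\<^bsub>M\<^esub> (b \<curlyvee>\<^bsub>M\<^esub> c) = a \<curlywedge>\<^bsub>M\<^esub> b \<curlyvee>\<^bsub>M\<^esub> a \<curlywedge>\<^bsub>M\<^esub> c"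
      using rule[OF _ abc e, of "Meet ?a (Join ?b ?c)" "Join (Meet ?a ?b) (Meet ?a ?c)"]
      by (simp add: val4[simplified] dist_lmonoid.meet_join_distrib D)
    fix d assume d: "d \<in> carrier M"
    show "a \<otimes>\<^bsub>M\<^esub> (b \<curlyvee>\<^bsub>M\<^esub> c) \<otimes>\<^bsub>M\<^esub> d = a \<otimes>\<^bsub>M\<^esub> b \<otimes>\<^bsub>M\<^esub> d \<curlyvee>\<^bsub>M\<^esub> a \<otimes>\<^bsub>M\<^esub> c \<otimes>\<^bsub>M\<^esub> d"
      using rule[OF _ abc d, of "Mult (Mult ?a (Join ?b ?c)) ?d"
          "Join (Mult (Mult ?a ?b) ?d) (Mult (Mult ?a ?c) ?d)"]
      by (simp add: val4[simplified] dist_lmonoid.mult_join_distrib D)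
    show "a \<otimes>\<^bsub>M\<^esub> (b \<curlywedge>\<^bsub>M\<^esub> c) \<otimes>\<^bsub>M\<^esub> d = a \<otimes>\<^bsub>M\<^esub> b \<otimes>\<^bsub>M\<^esub> d \<curlywedge>\<^bsub>M\<^esub> (a \<otimes>\<^bsub>M\<^esub> c \<otimes>\<^bsub>M\<^esub> d)"
      using rule[OF _ abc d, of "Mult (Mult ?a (Meet ?b ?c)) ?d"
          "Meet (Mult (Mult ?a ?b) ?d) (Mult (Mult ?a ?c) ?d)"]
      by (simp add: val4[simplified] dist_lmonoid.mult_meet_distrib D)
  next
    fix a b assume ab: "a \<in> carrier M" "b \<in> carrier M"
    show "a \<otimes>\<^bsub>M\<^esub> b \<in> carrier M" by (rule mult_closed[OF ab])
    show "a \<curlywedge>\<^bsub>M\<^esub> b = b \<curlywedge>\<^bsub>M\<^esub> a"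
      using rule[OF _ ab e e, of "Meet ?a ?b" "Meet ?b ?a"]
      by (simp add: val4[simplified] dist_lmonoid.meet_comm D)
    show "a \<curlyvee>\<^bsub>M\<^esub> b = b \<curlyvee>\<^bsub>M\<^esub> a"
      using rule[OF _ ab e e, of "Join ?a ?b" "Join ?b ?a"]
      by (simp add: val4[simplified] dist_lmonoid.join_comm D)
    show "a \<curlywedge>\<^bsub>M\<^esub> (a \<curlyvee>\<^bsub>M\<^esub> b) = a"
      using rule[OF _ ab e e, of "Meet ?a (Join ?a ?b)" "?a"]
      by (simp add: val4[simplified] dist_lmonoid.meet_absorb D)
    show "a \<curlyvee>\<^bsub>M\<^esub> a \<curlywedge>\<^bsub>M\<^esub> b = a"
      using rule[OF _ ab e e, of "Join ?a (Meet ?a ?b)" "?a"]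
      by (simp add: val4[simplified] dist_lmonoid.join_absorb D)
    show "a \<otimes>\<^bsub>M\<^esub> b = b \<otimes>\<^bsub>M\<^esub> a"
      using rule[OF _ ab e e, of "Mult ?a ?b" "Mult ?b ?a"]
      by (simp add: val4[simplified] comm_monoid.m_comm ax)
  next
    fix a assume a: "a \<in> carrier M"
    show "\<one>\<^bsub>M\<^esub> \<otimes>\<^bsub>M\<^esub> a = a"
      using rule[OF _ a e e e, of "Mult One ?a" "?a"]
      by (simp add: val4[simplified] monoid.l_one ax)
    show "a \<otimes>\<^bsub>M\<^esub> \<one>\<^bsub>M\<^esub> = a"
      using rule[OF _ a e e e, of "Mult ?a One" "?a"]
      by (simp add: val4[simplified] monoid.r_one ax)
    show "a \<otimes>\<^bsub>M\<^esub> a = a"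
      using rule[OF _ a e e e, of "Mult ?a ?a" "?a"]
      by (simp add: val4[simplified] comm_idem_dist_lmonoid.mult_idem)
  qed (rule e)
qed

lemma variety_subset_CIdDLM: "K \<subseteq> CIdDLM \<Longrightarrow> variety K \<subseteq> CIdDLM"
proof
  fix M assume K: "K \<subseteq> CIdDLM" and M: "M \<in> variety K"
  show "M \<in> CIdDLM"
  proof (rule CIdDLM_transfer)
    show "lm_algebra M" using M by (simp add: variety_def)
    show "A \<in> K \<Longrightarrow> A \<in> CIdDLM" for A using K by blast
    show "(\<And>A. A \<in> K \<Longrightarrow> A \<Turnstile> q) \<Longrightarrow> M \<Turnstile> q" for q :: "var equation"
      by (rule varietyD[OF M])
  qed
qed

lemma CIdDLM_lm_algebra: "M \<in> CIdDLM \<Longrightarrow> lm_algebra M"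
  by (simp add: CIdDLM_def comm_idem_dist_lmonoid.axioms(1) dist_lmonoid.axioms(1))

lemma CIdDLM_hom_image:
  assumes M: "M \<in> CIdDLM" and Q: "lm_algebra Q" and h: "surj_lm_hom h M Q"
  shows "Q \<in> CIdDLM"
  using CIdDLM_transfer[OF Q, of "{M}"] satisfies_hom_image[OF CIdDLM_lm_algebra[OF M] h] M
  by blast

section \<open>The lattice order\<close>

context comm_idem_dist_lmonoid
begin

abbreviation le (infix \<open>\<preceq>\<close> 50) where "a \<preceq> b \<equiv> lle M a b"

lemmas op_closed [simp] = one_closed mult_closed meet_closed join_closed

lemma meet_idem: "a \<in> carrier M \<Longrightarrow> a \<curlywedge> a = a"
  by (metis join_absorb meet_absorb meet_closed)

lemma le_refl: "a \<in> carrier M \<Longrightarrow> a \<preceq> a"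
  by (simp add: lle_def meet_idem)

lemma le_antisym: "\<lbrakk>a \<preceq> b; b \<preceq> a; a \<in> carrier M; b \<in> carrier M\<rbrakk> \<Longrightarrow> a = b"
  by (metis lle_def meet_comm)

lemma le_trans:
  "\<lbrakk>a \<preceq> b; b \<preceq> c; a \<in> carrier M; b \<in> carrier M; c \<in> carrier M\<rbrakk> \<Longrightarrow> a \<preceq> c"
  by (metis lle_def meet_assoc)

lemma le_iff_join: "\<lbrakk>a \<in> carrier M; b \<in> carrier M\<rbrakk> \<Longrightarrow> a \<preceq> b \<longleftrightarrow> a \<curlyvee> b = b"
  by (metis join_absorb join_comm lle_def meet_absorb meet_comm)

lemma meet_le:
  assumes "a \<in> carrier M" "b \<in> carrier M"
  shows "a \<curlywedge> b \<preceq> a" "a \<curlywedge> b \<preceq> b"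
  using assms by (metis lle_def meet_assoc meet_comm meet_idem)+

lemma le_join:
  assumes "a \<in> carrier M" "b \<in> carrier M"
  shows "a \<preceq> a \<curlyvee> b" "b \<preceq> a \<curlyvee> b"
  using assms by (metis lle_def meet_absorb join_comm)+

lemma le_meet_iff:
  assumes "a \<in> carrier M" "b \<in> carrier M" "c \<in> carrier M"
  shows "c \<preceq> a \<curlywedge> b \<longleftrightarrow> c \<preceq> a \<and> c \<preceq> b"
  using assms meet_le[of a b] le_trans[of c "a \<curlywedge> b"]
  by (auto simp: lle_def meet_assoc[symmetric])

lemma join_le_iff:
  assumes "a \<in> carrier M" "b \<in> carrier M" "c \<in> carrier M"
  shows "a \<curlyvee> b \<preceq> c \<longleftrightarrow> a \<preceq> c \<and> b \<preceq> c"
proof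
  assume "a \<curlyvee> b \<preceq> c" then show "a \<preceq> c \<and> b \<preceq> c"
    using assms le_join[of a b] le_trans by (meson join_closed)
next
  assume "a \<preceq> c \<and> b \<preceq> c" then show "a \<curlyvee> b \<preceq> c"
    using assms by (simp add: le_iff_join join_assoc)
qed

lemma join_mono:
  assumes "a \<preceq> b" "c \<preceq> d" "a \<in> carrier M" "b \<in> carrier M" "c \<in> carrier M" "d \<in> carrier M"
  shows "a \<curlyvee> c \<preceq> b \<curlyvee> d"
proof -
  have "a \<preceq> b \<curlyvee> d" by (rule le_trans[of a b]) (use assms le_join(1) in auto)
  moreover have "c \<preceq> b \<curlyvee> d" by (rule le_trans[of c d]) (use assms le_join(2) in auto)
  ultimately show ?thesis using assms by (simp add: join_le_iff)
qed

lemma mult_join: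
  "\<lbrakk>a \<in> carrier M; b \<in> carrier M; c \<in> carrier M\<rbrakk> \<Longrightarrow> a \<otimes> (b \<curlyvee> c) = a \<otimes> b \<curlyvee> a \<otimes> c"
  using mult_join_distrib[of a b c \<one>] by simp

lemma mult_meet:
  "\<lbrakk>a \<in> carrier M; b \<in> carrier M; c \<in> carrier M\<rbrakk> \<Longrightarrow> a \<otimes> (b \<curlywedge> c) = (a \<otimes> b) \<curlywedge> (a \<otimes> c)"
  using mult_meet_distrib[of a b c \<one>] by simp

lemma mult_left_mono:
  "\<lbrakk>b \<preceq> c; a \<in> carrier M; b \<in> carrier M; c \<in> carrier M\<rbrakk> \<Longrightarrow> a \<otimes> b \<preceq> a \<otimes> c"
  by (metis lle_def mult_meet)

lemma mult_mono:
  assumes "a \<preceq> b" "c \<preceq> d" "a \<in> carrier M" "b \<in> carrier M" "c \<in> carrier M" "d \<in> carrier M"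
  shows "a \<otimes> c \<preceq> b \<otimes> d"
  using assms mult_left_mono[of c d b] mult_left_mono[of a b c] le_trans[of "a \<otimes> c" "b \<otimes> c"]
  by (simp add: m_comm)

lemma join_meet_distrib:
  assumes "a \<in> carrier M" "b \<in> carrier M" "c \<in> carrier M"
  shows "a \<curlyvee> (b \<curlywedge> c) = (a \<curlyvee> b) \<curlywedge> (a \<curlyvee> c)"
proof -
  have "(a \<curlyvee> b) \<curlywedge> (a \<curlyvee> c) = (a \<curlyvee> b) \<curlywedge> a \<curlyvee> (a \<curlyvee> b) \<curlywedge> c"
    using assms by (simp add: meet_join_distrib)
  also have "\<dots> = a \<curlyvee> (c \<curlywedge> a \<curlyvee> c \<curlywedge> b)"
    using assms by (simp add: meet_comm[of "a \<curlyvee> b"] meet_absorb meet_join_distrib)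
  also have "\<dots> = (a \<curlyvee> a \<curlywedge> c) \<curlyvee> b \<curlywedge> c"
    using assms by (simp add: join_assoc meet_comm)
  finally show ?thesis using assms by (simp add: join_absorb)
qed

section \<open>Prime ideals and totally ordered quotients\<close>

text \<open>
  The empty set and the whole carrier are admitted as well; they only yield trivial quotients.
\<close>

definition prime_ideal :: "'a set \<Rightarrow> bool" where
  "prime_ideal I \<longleftrightarrow> I \<subseteq> carrier M \<and> (\<forall>a\<in>carrier M. \<forall>b\<in>carrier M.
     (a \<curlyvee> b \<in> I \<longleftrightarrow> a \<in> I \<and> b \<in> I) \<and> (a \<curlywedge> b \<in> I \<longleftrightarrow> a \<in> I \<or> b \<in> I))"

text \<open>
  The prime ideal theorem for distributive lattices: an ideal that is maximal among those containing
  \<open>v\<close> but not \<open>u\<close> is prime, since if it missed \<open>a\<close> and \<open>b\<close>, then \<open>u\<close> would lie below \<open>k \<curlyvee> a\<close> and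
  \<open>k \<curlyvee> b\<close> for some member \<open>k\<close>, hence below \<open>k \<curlyvee> (a \<curlywedge> b)\<close>.
\<close>

lemma prime_ideal_separation:
  assumes u: "u \<in> carrier M" and v: "v \<in> carrier M" and uv: "\<not> u \<preceq> v"
  shows "\<exists>I. prime_ideal I \<and> v \<in> I \<and> u \<notin> I"
proof -
  define ideal where "ideal = (\<lambda>I. I \<subseteq> carrier M \<and> v \<in> I \<and>
    (\<forall>a\<in>I. \<forall>b\<in>carrier M. b \<preceq> a \<longrightarrow> b \<in> I) \<and> (\<forall>a\<in>I. \<forall>b\<in>I. a \<curlyvee> b \<in> I))"
  let ?\<A> = "{I. ideal I \<and> u \<notin> I}"
  have "{a \<in> carrier M. a \<preceq> v} \<in> ?\<A>"
    using u v uv le_trans by (auto simp: ideal_def le_refl join_le_iff)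
  then have ne: "?\<A> \<noteq> {}" by blast
  have "\<Union>\<C> \<in> ?\<A>" if ne: "\<C> \<noteq> {}" and ch: "subset.chain ?\<A> \<C>" for \<C>
  proof -
    have I: "ideal I" "u \<notin> I" if "I \<in> \<C>" for I
      using ch that by (auto simp: subset.chain_def)
    have "a \<curlyvee> b \<in> \<Union>\<C>" if ab: "a \<in> \<Union>\<C>" "b \<in> \<Union>\<C>" for a b
    proof -
      obtain I J where IJ: "I \<in> \<C>" "J \<in> \<C>" "a \<in> I" "b \<in> J" using ab by blast
      then have "I \<subseteq> J \<or> J \<subseteq> I" using ch by (auto simp: subset.chain_def)
      then show ?thesis using IJ I(1)[OF IJ(1)] I(1)[OF IJ(2)] unfolding ideal_def by blast
    qed
    moreover have "\<Union>\<C> \<subseteq> carrier M" "v \<in> \<Union>\<C>"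
      using I(1) ne unfolding ideal_def by blast+
    moreover have "b \<in> \<Union>\<C>" if "a \<in> \<Union>\<C>" "b \<in> carrier M" "b \<preceq> a" for a b
      using that I(1) unfolding ideal_def by blast
    ultimately have "ideal (\<Union>\<C>)" unfolding ideal_def by blast
    then show ?thesis using I(2) by blast
  qed
  from subset_Zorn_nonempty[OF ne this]
  obtain I where I: "ideal I" "u \<notin> I" and max: "\<And>J. \<lbrakk>ideal J; u \<notin> J; I \<subseteq> J\<rbrakk> \<Longrightarrow> J = I"
    by auto
  have sub: "\<And>a. a \<in> I \<Longrightarrow> a \<in> carrier M" and vI: "v \<in> I"
    and down: "\<And>a b. \<lbrakk>a \<in> I; b \<in> carrier M; b \<preceq> a\<rbrakk> \<Longrightarrow> b \<in> I"
    and join: "\<And>a b. \<lbrakk>a \<in> I; b \<in> I\<rbrakk> \<Longrightarrow> a \<curlyvee> b \<in> I"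
    using I(1) unfolding ideal_def by blast+
  have reach: "\<exists>i\<in>I. u \<preceq> i \<curlyvee> a" if a: "a \<in> carrier M" "a \<notin> I" for a
  proof (rule ccontr)
    assume none: "\<not> (\<exists>i\<in>I. u \<preceq> i \<curlyvee> a)"
    let ?J = "{x \<in> carrier M. \<exists>i\<in>I. x \<preceq> i \<curlyvee> a}"
    have IJ: "I \<subseteq> ?J" using sub le_join(1) a by blast
    have "ideal ?J"
      unfolding ideal_def
    proof (intro conjI ballI impI)
      show "?J \<subseteq> carrier M" "v \<in> ?J" using IJ vI by blast+
    next
      fix x y assume x: "x \<in> ?J" and y: "y \<in> carrier M" "y \<preceq> x"
      then obtain i where i: "i \<in> I" "x \<preceq> i \<curlyvee> a" "x \<in> carrier M" by blast
      then have "y \<preceq> i \<curlyvee> a" using y sub[OF i(1)] a le_trans[of y x] by simp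
      then show "y \<in> ?J" using i y by blast
    next
      fix x y assume "x \<in> ?J" "y \<in> ?J"
      then obtain i j where ij: "i \<in> I" "j \<in> I" "x \<preceq> i \<curlyvee> a" "y \<preceq> j \<curlyvee> a"
        and xy: "x \<in> carrier M" "y \<in> carrier M" by blast
      have ijM: "i \<in> carrier M" "j \<in> carrier M" using ij sub by auto
      have "i \<curlyvee> a \<preceq> (i \<curlyvee> j) \<curlyvee> a" "j \<curlyvee> a \<preceq> (i \<curlyvee> j) \<curlyvee> a"
        using ijM a by (auto intro!: join_mono le_join le_refl)
      then have "x \<preceq> (i \<curlyvee> j) \<curlyvee> a" "y \<preceq> (i \<curlyvee> j) \<curlyvee> a"
        using ij(3,4) xy ijM a(1) by (meson le_trans join_closed)+
      then have "x \<curlyvee> y \<preceq> (i \<curlyvee> j) \<curlyvee> a"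
        using xy ijM a(1) by (simp add: join_le_iff)
      then show "x \<curlyvee> y \<in> ?J" using join[OF ij(1,2)] xy by auto
    qed
    moreover have "u \<notin> ?J" using none by blast
    moreover have "a \<in> ?J" using vI v a le_join(2) by blast
    ultimately show False using max IJ a by blast
  qed
  have "prime_ideal I"
    unfolding prime_ideal_def
  proof (intro conjI ballI)
    show "I \<subseteq> carrier M" using sub by blast
    fix a b assume ab: "a \<in> carrier M" "b \<in> carrier M"
    show "a \<curlyvee> b \<in> I \<longleftrightarrow> a \<in> I \<and> b \<in> I"
      using join down[OF _ ab(1)] down[OF _ ab(2)] le_join[OF ab] by blast
    show "a \<curlywedge> b \<in> I \<longleftrightarrow> a \<in> I \<or> b \<in> I"
    proof
      assume meet: "a \<curlywedge> b \<in> I"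
      show "a \<in> I \<or> b \<in> I"
      proof (rule ccontr)
        assume "\<not> (a \<in> I \<or> b \<in> I)"
        then obtain i j where i: "i \<in> I" "u \<preceq> i \<curlyvee> a" and j: "j \<in> I" "u \<preceq> j \<curlyvee> b"
          using reach ab by blast
        let ?k = "i \<curlyvee> j"
        have ij: "i \<in> carrier M" "j \<in> carrier M" using i j sub by auto
        have "i \<curlyvee> a \<preceq> ?k \<curlyvee> a" "j \<curlyvee> b \<preceq> ?k \<curlyvee> b"
          using ij ab by (auto intro!: join_mono le_join le_refl)
        then have "u \<preceq> ?k \<curlyvee> a" "u \<preceq> ?k \<curlyvee> b"
          using i(2) j(2) ij ab u by (meson le_trans join_closed)+
        then have "u \<preceq> (?k \<curlyvee> a) \<curlywedge> (?k \<curlyvee> b)"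
          using ij ab u by (simp add: le_meet_iff)
        then have "u \<preceq> ?k \<curlyvee> a \<curlywedge> b" using ij ab by (simp add: join_meet_distrib)
        moreover have "?k \<curlyvee> a \<curlywedge> b \<in> I" using i j meet join by blast
        ultimately show False using I(2) u down by blast
      qed
    next
      assume "a \<in> I \<or> b \<in> I" then show "a \<curlywedge> b \<in> I"
        using down[OF _ meet_closed[OF ab]] meet_le[OF ab] by blast
    qed
  qed
  then show ?thesis using vI I(2) by blast
qed

text \<open>
  The trace of \<open>a\<close> is the residual of the prime ideal by \<open>a\<close>. By distributivity of products over
  joins and meets it is a prime ideal again (possibly improper), and \<open>a \<mapsto> trace I a\<close> turns meets
  into unions and joins into intersections.
\<close>

definition trace :: "'a set \<Rightarrow> 'a \<Rightarrow> 'a set" where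
  "trace I a = {x \<in> carrier M. x \<otimes> a \<in> I}"

text \<open>
  By commutativity \<open>x \<in> trace I (a \<otimes> b)\<close> iff \<open>x \<otimes> a \<in> trace I b\<close> iff \<open>x \<otimes> b \<in> trace I a\<close>, so the
  trace of a product depends on the traces of the factors only, and any representative of the first
  factor serves to define the product.
\<close>

definition trace_alg :: "'a set \<Rightarrow> 'a set lmonoid" where
  "trace_alg I = \<lparr>carrier = trace I ` carrier M,
     mult = (\<lambda>A B. {x \<in> carrier M. x \<otimes> (SOME a. a \<in> carrier M \<and> trace I a = A) \<in> B}),
     one = trace I \<one>, lmeet = (\<union>), ljoin = (\<inter>)\<rparr>"

lemma trace_hom:
  assumes I: "prime_ideal I"
  shows "surj_lm_hom (trace I) M (trace_alg I)"
  unfolding surj_lm_hom_def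
proof (intro conjI ballI)
  fix a b assume a: "a \<in> carrier M" and b: "b \<in> carrier M"
  show "trace I (a \<curlywedge> b) = trace I a \<curlywedge>\<^bsub>trace_alg I\<^esub> trace I b"
    "trace I (a \<curlyvee> b) = trace I a \<curlyvee>\<^bsub>trace_alg I\<^esub> trace I b"
    using I a b unfolding prime_ideal_def by (auto simp: trace_def trace_alg_def mult_meet mult_join)
  let ?a = "SOME a'. a' \<in> carrier M \<and> trace I a' = trace I a"
  have a': "?a \<in> carrier M \<and> trace I ?a = trace I a"
    by (rule someI[of _ a]) (use a in simp)
  have "x \<otimes> (a \<otimes> b) \<in> I \<longleftrightarrow> x \<otimes> ?a \<otimes> b \<in> I" if x: "x \<in> carrier M" for x
  proof -
    have "x \<otimes> b \<in> trace I a \<longleftrightarrow> x \<otimes> b \<in> trace I ?a" using a' by simp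
    moreover have "x \<otimes> b \<otimes> ?a = x \<otimes> ?a \<otimes> b" "x \<otimes> b \<otimes> a = x \<otimes> (a \<otimes> b)"
      using x a b a' by (simp_all add: m_ac)
    ultimately show ?thesis using x b by (simp add: trace_def)
  qed
  then show "trace I (a \<otimes> b) = trace I a \<otimes>\<^bsub>trace_alg I\<^esub> trace I b"
    using a' b by (auto simp: trace_def[of I b] trace_def[of I "a \<otimes> b"] trace_alg_def)
qed (simp_all add: trace_alg_def)

lemma trace_alg_closed:
  assumes I: "prime_ideal I"
  shows "lm_algebra (trace_alg I)"
proof -
  have h: "trace I ` carrier M = carrier (trace_alg I)" by (simp add: trace_alg_def)
  note hom = trace_hom[OF I, unfolded surj_lm_hom_def]
  show ?thesis
  proof
    show "\<one>\<^bsub>trace_alg I\<^esub> \<in> carrier (trace_alg I)" by (simp add: trace_alg_def)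
  next
    fix A B assume "A \<in> carrier (trace_alg I)" "B \<in> carrier (trace_alg I)"
    then obtain a b where ab: "a \<in> carrier M" "b \<in> carrier M" "A = trace I a" "B = trace I b"
      by (auto simp: trace_alg_def)
    show "A \<otimes>\<^bsub>trace_alg I\<^esub> B \<in> carrier (trace_alg I)"
      "A \<curlywedge>\<^bsub>trace_alg I\<^esub> B \<in> carrier (trace_alg I)"
      "A \<curlyvee>\<^bsub>trace_alg I\<^esub> B \<in> carrier (trace_alg I)"
      unfolding h[symmetric] ab(3,4) using hom ab(1,2)
      by (metis imageI op_closed(2), metis imageI op_closed(3), metis imageI op_closed(4))
  qed
qed

text \<open>
  If \<open>x\<close> and \<open>y\<close> witness that neither trace contains the other, consider
  \<open>(x \<curlyvee> y) \<otimes> (a \<curlywedge> b)\<close>. It belongs to \<open>I\<close>, as \<open>x \<otimes> a\<close> and \<open>y \<otimes> b\<close> do; by primality so does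
  \<open>(x \<curlyvee> y) \<otimes> a\<close> or \<open>(x \<curlyvee> y) \<otimes> b\<close>, hence \<open>y \<otimes> a\<close> or \<open>x \<otimes> b\<close>.
\<close>

lemma trace_total:
  assumes I: "prime_ideal I" and a: "a \<in> carrier M" and b: "b \<in> carrier M"
  shows "trace I a \<subseteq> trace I b \<or> trace I b \<subseteq> trace I a"
proof (rule ccontr)
  assume "\<not> ?thesis"
  then obtain x y where x: "x \<in> carrier M" "x \<otimes> a \<in> I" "x \<otimes> b \<notin> I"
    and y: "y \<in> carrier M" "y \<otimes> b \<in> I" "y \<otimes> a \<notin> I"
    by (auto simp: trace_def)
  have J: "p \<curlyvee> q \<in> I \<longleftrightarrow> p \<in> I \<and> q \<in> I" and P: "p \<curlywedge> q \<in> I \<longleftrightarrow> p \<in> I \<or> q \<in> I"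
    if "p \<in> carrier M" "q \<in> carrier M" for p q
    using I that unfolding prime_ideal_def by blast+
  have split: "(x \<curlyvee> y) \<otimes> c = x \<otimes> c \<curlyvee> y \<otimes> c" if "c \<in> carrier M" for c
    using x y that by (simp add: m_comm[of _ c] mult_join)
  have "x \<otimes> (a \<curlywedge> b) \<in> I" "y \<otimes> (a \<curlywedge> b) \<in> I"
    using x y a b by (simp_all add: mult_meet P)
  then have "(x \<curlyvee> y) \<otimes> (a \<curlywedge> b) \<in> I" using x y a b by (simp add: split J)
  then have "(x \<curlyvee> y) \<otimes> a \<in> I \<or> (x \<curlyvee> y) \<otimes> b \<in> I"
    using x y a b by (simp add: mult_meet P)
  then show False using x y a b by (simp add: split J)
qed

end

locale comm_idem_ordered_monoid = comm_idem_dist_lmonoid M for M :: "'a lmonoid" (structure) +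
  assumes le_total: "\<lbrakk>a \<in> carrier M; b \<in> carrier M\<rbrakk> \<Longrightarrow> lle M a b \<or> lle M b a"

text \<open>
  The quotients by traces form a subdirect representation: two elements with the same trace for the
  prime ideal \<open>I\<close> are both in \<open>I\<close> or both outside, because \<open>\<one>\<close> belongs to \<open>trace I a\<close> iff \<open>a \<in> I\<close>.
  Hence prime ideals that separate elements yield chains that separate them.
\<close>

lemma CIdDLM_satisfies_if_chains_satisfy:
  fixes M :: "'a lmonoid"
  assumes M: "M \<in> CIdDLM"
    and chains: "\<And>(Q :: 'a set lmonoid) h. \<lbrakk>comm_idem_ordered_monoid Q; surj_lm_hom h M Q\<rbrakk> \<Longrightarrow> Q \<Turnstile> q"
  shows "M \<Turnstile> q"
  unfolding satisfies_def
proof (rule ballI, rule ccontr)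
  interpret comm_idem_dist_lmonoid M using M by (simp add: CIdDLM_def)
  fix f assume f: "f \<in> UNIV \<rightarrow> carrier M" and neq: "eval M f (fst q) \<noteq> eval M f (snd q)"
  let ?u = "eval M f (fst q)" and ?v = "eval M f (snd q)"
  have uv: "?u \<in> carrier M" "?v \<in> carrier M"
    using f by (auto intro!: eval_closed CIdDLM_lm_algebra[OF M])
  then have "\<not> ?u \<preceq> ?v \<or> \<not> ?v \<preceq> ?u" using neq le_antisym by blast
  then obtain I where I: "prime_ideal I" and sep: "?u \<in> I \<longleftrightarrow> ?v \<notin> I"
    using prime_ideal_separation uv by metis
  note hom = trace_hom[OF I]
  have Q: "trace_alg I \<in> CIdDLM" by (rule CIdDLM_hom_image[OF M trace_alg_closed[OF I] hom])
  have "comm_idem_ordered_monoid (trace_alg I)"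
  proof (intro comm_idem_ordered_monoid.intro comm_idem_ordered_monoid_axioms.intro)
    show "comm_idem_dist_lmonoid (trace_alg I)" using Q by (simp add: CIdDLM_def)
  next
    fix A B assume "A \<in> carrier (trace_alg I)" "B \<in> carrier (trace_alg I)"
    then have "A \<subseteq> B \<or> B \<subseteq> A" using trace_total[OF I] by (auto simp: trace_alg_def)
    then show "lle (trace_alg I) A B \<or> lle (trace_alg I) B A"
      by (auto simp: lle_def trace_alg_def)
  qed
  from chains[OF this hom] have "trace_alg I \<Turnstile> q" .
  moreover have "trace I \<circ> f \<in> UNIV \<rightarrow> carrier (trace_alg I)" using f by (auto simp: trace_alg_def)
  ultimately have "eval (trace_alg I) (trace I \<circ> f) (fst q) = eval (trace_alg I) (trace I \<circ> f) (snd q)"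
    by (auto simp: satisfies_def)
  then have "trace I ?u = trace I ?v"
    using eval_hom[OF CIdDLM_lm_algebra[OF M] hom, of _ f] f by auto
  then have "\<one>\<^bsub>M\<^esub> \<in> trace I ?u \<longleftrightarrow> \<one>\<^bsub>M\<^esub> \<in> trace I ?v" by simp
  then show False using sep uv by (simp add: trace_def)
qed

text \<open>
  Completeness has to be checked for ordered monoids only. They occur over the type of sets
  because they are constructed as algebras of traces.
\<close>

lemma axiomatizes_relI:
  fixes q :: "var equation"
  assumes K: "K \<subseteq> CIdDLM" and sound: "\<And>A. A \<in> K \<Longrightarrow> A \<Turnstile> q"
    and chains: "\<And>Q :: 'a set lmonoid. \<lbrakk>comm_idem_ordered_monoid Q; Q \<Turnstile> q\<rbrakk> \<Longrightarrow> Q \<in> variety K"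
  shows "axiomatizes_rel q (variety K) (CIdDLM :: 'a lmonoid set)"
  unfolding axiomatizes_rel_def
proof (intro equalityI subsetI)
  fix M :: "'a lmonoid" assume "M \<in> variety K"
  then show "M \<in> {M \<in> CIdDLM. M \<Turnstile> q}"
    using variety_subset_CIdDLM[OF K] varietyD sound by blast
next
  fix M :: "'a lmonoid" assume "M \<in> {M \<in> CIdDLM. M \<Turnstile> q}"
  then have M: "M \<in> CIdDLM" "M \<Turnstile> q" by auto
  show "M \<in> variety K"
  proof (rule varietyI[OF CIdDLM_lm_algebra[OF M(1)]])
    fix r :: "var equation" assume r: "\<And>A. A \<in> K \<Longrightarrow> A \<Turnstile> r"
    show "M \<Turnstile> r"
    proof (rule CIdDLM_satisfies_if_chains_satisfy[OF M(1)])
      fix Q :: "'a set lmonoid" and h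
      assume "comm_idem_ordered_monoid Q" "surj_lm_hom h M Q"
      then have "Q \<in> variety K"
        using chains satisfies_hom_image[OF CIdDLM_lm_algebra[OF M(1)]] M(2) by blast
      then show "Q \<Turnstile> r" using varietyD r by blast
    qed
  qed
qed

section \<open>Alternating sequences and the equations\<close>

text \<open>
  In an ordered monoid \<open>a \<otimes> b = b\<close> says that \<open>b\<close> absorbs \<open>a\<close>. The sequence
  \<open>x\<^sub>1, \<dots>, x\<^sub>k\<close> alternates between elements strictly above and strictly below the identity,
  beginning above it, and each entry is absorbed by the next one. Such sequences are exactly the
  obstructions to \<open>\<sigma>\<close>.
\<close>

definition alternating :: "'a lmonoid \<Rightarrow> nat \<Rightarrow> (nat \<Rightarrow> 'a) \<Rightarrow> bool" where
  "alternating M k x \<longleftrightarrow>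
     (\<forall>i. 1 \<le> i \<and> i \<le> k \<longrightarrow> x i \<in> carrier M \<and> x i \<noteq> \<one>\<^bsub>M\<^esub> \<and>
        (if odd i then lle M \<one>\<^bsub>M\<^esub> (x i) else lle M (x i) \<one>\<^bsub>M\<^esub>)) \<and>
     (\<forall>i. 1 \<le> i \<and> i < k \<longrightarrow> x i \<otimes>\<^bsub>M\<^esub> x (Suc i) = x (Suc i))"

lemma alternating_le: "\<lbrakk>alternating M k x; j \<le> k\<rbrakk> \<Longrightarrow> alternating M j x"
  by (auto simp: alternating_def)

lemma alternating_cong: "(\<And>i. \<lbrakk>1 \<le> i; i \<le> k\<rbrakk> \<Longrightarrow> x i = y i) \<Longrightarrow> alternating M k x = alternating M k y"
  by (auto simp: alternating_def)

lemma alternating_Suc: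
  "alternating M (Suc k) x \<longleftrightarrow> alternating M k x \<and> x (Suc k) \<in> carrier M \<and> x (Suc k) \<noteq> \<one>\<^bsub>M\<^esub> \<and>
     (if even k then lle M \<one>\<^bsub>M\<^esub> (x (Suc k)) else lle M (x (Suc k)) \<one>\<^bsub>M\<^esub>) \<and>
     (0 < k \<longrightarrow> x k \<otimes>\<^bsub>M\<^esub> x (Suc k) = x (Suc k))"
  by (auto simp: alternating_def le_Suc_eq less_Suc_eq)

lemma s_trm_2: "s_trm 2 = Var (X 1)" and t_trm_2: "t_trm 2 = One"
  by (simp_all add: numeral_2_eq_2)

context comm_idem_dist_lmonoid
begin

lemma one_le_t_trm:
  assumes f: "\<And>v. f v \<in> carrier M"
  shows "\<one> \<preceq> eval M f (t_trm n)"
proof (induction n)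
  case (Suc n)
  have "eval M f t \<in> carrier M" for t by (rule eval_closed) (use f lm_algebra_axioms in auto)
  then show ?case
    using Suc f le_trans[OF Suc le_join(1)] by (auto simp: le_refl)
qed (simp add: le_refl)

lemma mult_one_le: "\<lbrakk>\<one> \<preceq> a; a \<in> carrier M; b \<in> carrier M\<rbrakk> \<Longrightarrow> b \<preceq> a \<otimes> b"
  using mult_mono[of \<one> a b b] by (simp add: le_refl)

lemma mult_le_one: "\<lbrakk>a \<preceq> \<one>; a \<in> carrier M; b \<in> carrier M\<rbrakk> \<Longrightarrow> a \<otimes> b \<preceq> b"
  using mult_mono[of a \<one> b b] by (simp add: le_refl)

lemma absorb_trans:
  "\<lbrakk>a \<otimes> b = b; b \<otimes> c = c; a \<in> carrier M; b \<in> carrier M; c \<in> carrier M\<rbrakk> \<Longrightarrow> a \<otimes> c = c"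
  by (metis m_assoc)

end

context comm_idem_ordered_monoid
begin

text \<open>
  If \<open>a \<otimes> b\<close> is below the identity, then multiplying it by \<open>a\<close>, which changes nothing by
  idempotence, shows that it is at most \<open>a\<close>; dually if it is above the identity.
\<close>

lemma mult_of_le:
  assumes a: "a \<in> carrier M" and b: "b \<in> carrier M" and ab: "a \<preceq> b"
  shows "a \<otimes> b = a \<or> a \<otimes> b = b"
proof -
  have lo: "a \<preceq> a \<otimes> b" and hi: "a \<otimes> b \<preceq> b"
    using mult_mono[of a a a b] mult_mono[of a b b b] a b ab by (simp_all add: mult_idem le_refl)
  consider "a \<otimes> b \<preceq> \<one>" | "\<one> \<preceq> a \<otimes> b" using le_total a b by (meson op_closed)
  then show ?thesis
  proof cases
    case 1
    then have "a \<otimes> b \<otimes> a \<preceq> a" using mult_le_one a b by simp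
    moreover have "a \<otimes> b \<otimes> a = a \<otimes> b" using a b by (metis m_assoc m_comm mult_idem)
    ultimately show ?thesis using lo le_antisym a b by simp
  next
    case 2
    then have "b \<preceq> a \<otimes> b \<otimes> b" using mult_one_le a b by simp
    moreover have "a \<otimes> b \<otimes> b = a \<otimes> b" using a b by (simp add: m_assoc mult_idem)
    ultimately show ?thesis using hi le_antisym a b by simp
  qed
qed

lemma mult_conservative: "\<lbrakk>a \<in> carrier M; b \<in> carrier M\<rbrakk> \<Longrightarrow> a \<otimes> b = a \<or> a \<otimes> b = b"
  using mult_of_le[of a b] mult_of_le[of b a] le_total[of a b] m_comm[of a b] by auto

lemma not_le: "\<lbrakk>\<not> a \<preceq> b; a \<in> carrier M; b \<in> carrier M\<rbrakk> \<Longrightarrow> b \<preceq> a \<and> b \<noteq> a"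
  using le_total[of a b] le_refl by auto

text \<open>
  An assignment that refutes \<open>\<sigma>\<^sub>n\<^sub>+\<^sub>1\<close> also refutes \<open>\<sigma>\<^sub>n\<close>, and in a chain the new product
  \<open>x\<^sub>n\<^sub>-\<^sub>1 x\<^sub>n\<close> is one of its factors. If it is added to the meet on the left, it lies above the
  identity, hence differs from \<open>x\<^sub>n\<^sub>-\<^sub>1\<close>, which lies below. If it is added to the join on the right, it
  lies strictly below \<open>s\<^sub>n\<close>, hence below \<open>x\<^sub>n\<^sub>-\<^sub>1\<close> provided that \<open>x\<^sub>n\<^sub>-\<^sub>1\<close> is an upper bound of
  \<open>s\<^sub>n\<close>; the second conjunct keeps track of this. In both cases the product is \<open>x\<^sub>n\<close>, on the
  other side of the identity.
\<close>

lemma alternating_if_sigma_fails: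
  assumes n: "2 \<le> n" and f: "\<And>v. f v \<in> carrier M"
    and fails: "\<not> eval M f (s_trm n) \<preceq> eval M f (t_trm n)"
  shows "alternating M (n - 1) (\<lambda>i. f (X i)) \<and> (even n \<longrightarrow> eval M f (s_trm n) \<preceq> f (X (n - 1)))"
  using n fails
proof (induction n rule: nat_induct_at_least)
  case base
  then show ?case using f not_le by (auto simp: s_trm_2 t_trm_2 alternating_def le_refl)
next
  case (Suc n)
  let ?s = "eval M f (s_trm n)" and ?t = "eval M f (t_trm n)"
  define x where "x = (\<lambda>i. f (X i))"
  let ?p = "x (n - 1) \<otimes> x n"
  have x: "x i \<in> carrier M" for i using f by (simp add: x_def)
  have s: "?s \<in> carrier M" and t: "?t \<in> carrier M"
    using f lm_algebra_axioms by (auto intro: eval_closed)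
  have t1: "\<one> \<preceq> ?t" by (rule one_le_t_trm[OF f])
  have p: "?p = x (n - 1) \<or> ?p = x n" using mult_conservative x by blast
  obtain m where m: "n = Suc m" "0 < m" using Suc.hyps by (cases n) auto
  show ?case
  proof (cases "even n")
    case True
    then have eqs: "eval M f (s_trm (Suc n)) = ?s" "eval M f (t_trm (Suc n)) = ?t \<curlyvee> ?p"
      using Suc.hyps by (simp_all add: x_def)
    have nle: "\<not> ?s \<preceq> ?t" "\<not> ?s \<preceq> ?p"
      using Suc.prems s t x le_trans[OF _ le_join(1)[of ?t ?p]] le_trans[OF _ le_join(2)[of ?t ?p]]
      unfolding eqs by (meson op_closed)+
    from Suc.IH[OF nle(1)] have alt: "alternating M m x" and sx: "?s \<preceq> x m"
      using True m by (auto simp: x_def)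
    have "\<one> \<preceq> x m" using alt m True by (auto simp: alternating_def)
    have pn: "?p = x n" using p nle(2) sx m by auto
    have "\<not> \<one> \<preceq> x n"
    proof
      assume "\<one> \<preceq> x n"
      then have "x m \<preceq> ?p" using mult_one_le[of "x n" "x m"] x m by (simp add: m_comm)
      then show False using nle(2) sx le_trans[of ?s "x m" ?p] s x by simp
    qed
    then have "x n \<preceq> \<one>" "x n \<noteq> \<one>" using not_le[of \<one> "x n"] x by auto
    then show ?thesis using alt pn x m True by (simp add: alternating_Suc x_def)
  next
    case False
    then have eqs: "eval M f (s_trm (Suc n)) = ?s \<curlywedge> ?p" "eval M f (t_trm (Suc n)) = ?t"
      using Suc.hyps by (simp_all add: x_def)
    have nle: "\<not> ?s \<preceq> ?t" "\<not> ?p \<preceq> ?t"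
      using Suc.prems s t x le_trans[OF meet_le(1)[of ?s ?p]] le_trans[OF meet_le(2)[of ?s ?p]]
      unfolding eqs by (meson op_closed)+
    from Suc.IH[OF nle(1)] have alt: "alternating M m x" using m by (auto simp: x_def)
    have neg: "x m \<preceq> \<one>" using alt m False by (auto simp: alternating_def)
    have np: "\<not> ?p \<preceq> \<one>" using nle(2) t1 le_trans[of ?p \<one> ?t] x t by auto
    then have pn: "?p = x n" using p neg m by auto
    then have "\<one> \<preceq> x n" "x n \<noteq> \<one>" using np not_le[of "x n" \<one>] x by auto
    moreover have "eval M f (s_trm (Suc n)) \<preceq> x n" unfolding eqs using meet_le(2) s x pn by metis
    ultimately show ?thesis using alt pn x m False by (simp add: alternating_Suc x_def)
  qed
qed

text \<open>
  On an alternating sequence every product in \<open>s\<close> and \<open>t\<close> is its right factor. So \<open>s\<close> is a meet of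
  elements above the identity, and \<open>t\<close> is a join of the identity and elements below it.
\<close>

lemma sigma_fails_if_alternating:
  assumes n: "2 \<le> n" and f: "\<And>v. f v \<in> carrier M"
    and alt: "alternating M (n - 1) (\<lambda>i. f (X i))"
  shows "eval M f (t_trm n) = \<one> \<and> \<not> eval M f (s_trm n) \<preceq> \<one>"
  using n alt
proof (induction n rule: nat_induct_at_least)
  case base
  then show ?case using f le_antisym[of "f (X (Suc 0))" \<one>]
    by (auto simp: s_trm_2 t_trm_2 alternating_def)
next
  case (Suc n)
  let ?s = "eval M f (s_trm n)"
  define x where "x = (\<lambda>i. f (X i))"
  have x: "x i \<in> carrier M" for i using f by (simp add: x_def)
  have s: "?s \<in> carrier M" using f lm_algebra_axioms by (auto intro: eval_closed)
  obtain m where m: "n = Suc m" "0 < m" using Suc.hyps by (cases n) auto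
  have alt: "alternating M (Suc m) x" using Suc.prems m by (simp add: x_def)
  then have p: "x m \<otimes> x n = x n" and ne: "x n \<noteq> \<one>"
    and sign: "if even m then \<one> \<preceq> x n else x n \<preceq> \<one>"
    using m by (auto simp: alternating_Suc)
  have IH: "eval M f (t_trm n) = \<one>" "\<not> ?s \<preceq> \<one>"
    using Suc.IH alt m by (auto simp: alternating_Suc x_def)
  show ?case
  proof (cases "even n")
    case True
    then have "eval M f (t_trm (Suc n)) = \<one> \<curlyvee> x n" "eval M f (s_trm (Suc n)) = ?s"
      using Suc.hyps IH p m by (simp_all add: x_def)
    moreover have "\<one> \<curlyvee> x n = \<one>" using sign True m x by (simp add: le_iff_join join_comm)
    ultimately show ?thesis using IH by simp
  next
    case False
    then have eqs: "eval M f (t_trm (Suc n)) = \<one>" "eval M f (s_trm (Suc n)) = ?s \<curlywedge> x n"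
      using Suc.hyps IH p m by (simp_all add: x_def)
    have "\<not> x n \<preceq> \<one>" using sign False m ne x le_antisym[of "x n" \<one>] by auto
    moreover have "?s \<curlywedge> x n = ?s \<or> ?s \<curlywedge> x n = x n"
      using le_total[OF s x[of n]] meet_comm[OF s x[of n]] by (auto simp: lle_def)
    ultimately show ?thesis unfolding eqs using IH by auto
  qed
qed

lemma satisfies_sigma_iff:
  assumes n: "2 \<le> n"
  shows "M \<Turnstile> \<sigma> n \<longleftrightarrow> (\<nexists>x. alternating M (n - 1) x)"
proof
  assume sat: "M \<Turnstile> \<sigma> n"
  show "\<nexists>x. alternating M (n - 1) x"
  proof
    assume "\<exists>x. alternating M (n - 1) x"
    then obtain x where x: "alternating M (n - 1) x" by blast
    define f where "f = (\<lambda>v. case v of X i \<Rightarrow> if 1 \<le> i \<and> i \<le> n - 1 then x i else \<one> | Y i \<Rightarrow> \<one>)"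
    have f: "f v \<in> carrier M" for v using x by (auto simp: f_def alternating_def split: var.split)
    have "alternating M (n - 1) (\<lambda>i. f (X i))"
      using x alternating_cong[of "n - 1" x "\<lambda>i. f (X i)"] by (simp add: f_def)
    from sigma_fails_if_alternating[OF n f this]
    have "\<not> eval M f (s_trm n) \<preceq> eval M f (t_trm n)" by simp
    then show False
      using sat f by (auto simp: satisfies_def \<sigma>_def leq_eqn_def lle_def)
  qed
next
  assume none: "\<nexists>x. alternating M (n - 1) x"
  show "M \<Turnstile> \<sigma> n"
    unfolding satisfies_def
  proof
    fix f :: "var \<Rightarrow> 'a" assume "f \<in> UNIV \<rightarrow> carrier M"
    then have "eval M f (s_trm n) \<preceq> eval M f (t_trm n)"
      using alternating_if_sigma_fails[OF n, of f] none by blast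
    then show "eval M f (fst (\<sigma> n)) = eval M f (snd (\<sigma> n))"
      by (simp add: \<sigma>_def leq_eqn_def lle_def)
  qed
qed

end

section \<open>The chains as algebras on levels\<close>

text \<open>
  Order and product of \<open>C n\<close> and \<open>C_dual n\<close> can be read off the signed labels: the order is that of
  the integers, and a product is the factor of greater absolute value. No label occurs on both sides
  of the identity, so ties between distinct factors do not arise and the product is commutative.
\<close>

primrec level :: "elt \<Rightarrow> int" where
  "level E = 0"
| "level (Bot k) = - int k"
| "level (Top k) = int k"

locale level_chain =
  fixes A :: "elt lmonoid" (structure)
  assumes one_eq: "\<one> = E" and E_carrier: "E \<in> carrier A"
    and abs_level_inj: "\<lbrakk>a \<in> carrier A; b \<in> carrier A; \<bar>level a\<bar> = \<bar>level b\<bar>\<rbrakk> \<Longrightarrow> a = b"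
    and mult_eq: "\<lbrakk>a \<in> carrier A; b \<in> carrier A\<rbrakk> \<Longrightarrow> a \<otimes> b = (if \<bar>level b\<bar> \<le> \<bar>level a\<bar> then a else b)"
    and meet_eq: "\<lbrakk>a \<in> carrier A; b \<in> carrier A\<rbrakk> \<Longrightarrow> a \<curlywedge> b = (if level a \<le> level b then a else b)"
    and join_eq: "\<lbrakk>a \<in> carrier A; b \<in> carrier A\<rbrakk> \<Longrightarrow> a \<curlyvee> b = (if level a \<le> level b then b else a)"
begin

lemma level_inj: "\<lbrakk>a \<in> carrier A; b \<in> carrier A; level a = level b\<rbrakk> \<Longrightarrow> a = b"
  using abs_level_inj by simp

lemma lle_iff_level: "\<lbrakk>a \<in> carrier A; b \<in> carrier A\<rbrakk> \<Longrightarrow> lle A a b \<longleftrightarrow> level a \<le> level b"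
  using level_inj[of a b] by (auto simp: lle_def meet_eq)

lemma level_mult_mono:
  assumes "level b \<le> level c" "a \<in> carrier A" "b \<in> carrier A" "c \<in> carrier A"
  shows "level (a \<otimes> b) \<le> level (a \<otimes> c)" "level (b \<otimes> a) \<le> level (c \<otimes> a)"
  using assms abs_level_inj[of a b] abs_level_inj[of a c] by (auto simp: mult_eq)

sublocale comm_idem_ordered_monoid A
proof unfold_locales
  have mc: "a \<otimes> b \<in> carrier A" if "a \<in> carrier A" "b \<in> carrier A" for a b
    using that by (simp add: mult_eq)
  fix a b assume a: "a \<in> carrier A" and b: "b \<in> carrier A"
  show "a \<otimes> b \<in> carrier A" "a \<curlywedge> b \<in> carrier A" "a \<curlyvee> b \<in> carrier A"
    using a b by (simp_all add: mult_eq meet_eq join_eq)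
  show "a \<curlywedge> b = b \<curlywedge> a" "a \<curlyvee> b = b \<curlyvee> a"
    using a b level_inj[of a b] by (auto simp: meet_eq join_eq)
  show "a \<otimes> b = b \<otimes> a"
    using a b abs_level_inj[of a b] by (auto simp: mult_eq)
  show "a \<curlywedge> (a \<curlyvee> b) = a" "a \<curlyvee> (a \<curlywedge> b) = a" using a b by (simp_all add: meet_eq join_eq)
  show "lle A a b \<or> lle A b a" using a b by (auto simp: lle_iff_level)
  fix c assume c: "c \<in> carrier A"
  show "a \<otimes> b \<otimes> c = a \<otimes> (b \<otimes> c)" using a b c by (simp add: mult_eq)
  show "(a \<curlywedge> b) \<curlywedge> c = a \<curlywedge> (b \<curlywedge> c)" using a b c by (simp add: meet_eq)
  show "(a \<curlyvee> b) \<curlyvee> c = a \<curlyvee> (b \<curlyvee> c)" using a b c by (simp add: join_eq)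
  show "a \<curlywedge> (b \<curlyvee> c) = (a \<curlywedge> b) \<curlyvee> (a \<curlywedge> c)"
    using a b c level_inj[of a b] level_inj[of a c] level_inj[of b c] by (auto simp: join_eq meet_eq)
  fix d assume d: "d \<in> carrier A"
  let ?b = "a \<otimes> b \<otimes> d" and ?c = "a \<otimes> c \<otimes> d"
  have car: "?b \<in> carrier A" "?c \<in> carrier A" using a b c d by (simp_all add: mc)
  have mono: "level b \<le> level c \<Longrightarrow> level ?b \<le> level ?c" "level c \<le> level b \<Longrightarrow> level ?c \<le> level ?b"
    using a b c d by (simp_all add: level_mult_mono mc)
  have "?b \<curlyvee> ?c = (if level b \<le> level c then ?c else ?b)"
    "?b \<curlywedge> ?c = (if level b \<le> level c then ?b else ?c)"
    unfolding join_eq[OF car] meet_eq[OF car] using mono level_inj[OF car]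
    by (metis linorder_linear order_antisym)+
  then show "a \<otimes> (b \<curlyvee> c) \<otimes> d = ?b \<curlyvee> ?c" "a \<otimes> (b \<curlywedge> c) \<otimes> d = ?b \<curlywedge> ?c"
    unfolding join_eq[OF b c] meet_eq[OF b c] by simp_all
next
  fix a assume a: "a \<in> carrier A"
  show "\<one> \<otimes> a = a" "a \<otimes> \<one> = a" using a E_carrier abs_level_inj[of a E] by (auto simp: one_eq mult_eq)
  show "a \<otimes> a = a" using a by (simp add: mult_eq)
qed (simp add: one_eq E_carrier)

lemma CIdDLM: "A \<in> CIdDLM"
  by (simp add: CIdDLM_def comm_idem_dist_lmonoid_axioms)

text \<open>
  An absorbing element has a greater absolute level, so the length of alternating sequences is
  limited by the labels.
\<close>

lemma alternating_level:
  assumes "alternating A (Suc k) x"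
  shows "\<bar>level (x 1)\<bar> + int k \<le> \<bar>level (x (Suc k))\<bar>"
  using assms
proof (induction k)
  case (Suc k)
  let ?a = "x (Suc k)" and ?b = "x (Suc (Suc k))"
  have car: "?a \<in> carrier A" "?b \<in> carrier A" and ab: "?a \<otimes> ?b = ?b" and ne: "?a \<noteq> \<one>"
    and alt: "alternating A (Suc k) x"
    using Suc.prems by (auto simp: alternating_Suc)
  have sign: "lle A ?a \<one> \<and> lle A \<one> ?b \<or> lle A \<one> ?a \<and> lle A ?b \<one>"
    using Suc.prems by (auto simp: alternating_Suc split: if_splits)
  then have "?a \<noteq> ?b" using le_antisym[of ?a \<one>] car ne by auto
  then have "\<bar>level ?a\<bar> < \<bar>level ?b\<bar>" using ab car by (auto simp: mult_eq split: if_splits)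
  then show ?case using Suc.IH[OF alt] by simp
qed simp

end

text \<open>
  The universe of \<open>C n\<close> or \<open>C_dual n\<close>: every label from 2 to \<open>n\<close> occurs once, and \<open>p\<close> tells which
  parity belongs to \<open>Bot\<close>. The algebra with \<open>p = True\<close>, in which the even labels are below the
  identity, is \<open>C n\<close> for even \<open>n\<close> and \<open>C_dual n\<close> for odd \<open>n\<close>, the one whose variety \<open>\<sigma> n\<close> axiomatizes.
\<close>

definition level_elts :: "bool \<Rightarrow> nat \<Rightarrow> elt set" where
  "level_elts p n = {E} \<union> {Bot k |k. 2 \<le> k \<and> k \<le> n \<and> even k = p} \<union> {Top k |k. 2 \<le> k \<and> k \<le> n \<and> even k \<noteq> p}"

text \<open>
  The element of the first summand absorbs the second summand and lies on one side of all of it, as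
  its label, the greatest one, prescribes.
\<close>

lemma nested_sum_level_chain:
  assumes M: "level_chain M" "carrier M = {E, z}" and N: "level_chain N"
    and lt: "\<And>b. b \<in> carrier N \<Longrightarrow> \<bar>level b\<bar> < \<bar>level z\<bar>"
  shows "level_chain (M \<boxplus> N)" "carrier (M \<boxplus> N) = insert z (carrier N)"
proof -
  interpret M: level_chain M by (rule M)
  interpret N: level_chain N by (rule N)
  have z: "level z \<noteq> 0" "z \<noteq> E" using lt[OF N.E_carrier] by auto
  have new: "z \<notin> carrier N" using lt[of z] by auto
  show car: "carrier (M \<boxplus> N) = insert z (carrier N)"
    using N.E_carrier by (auto simp: nested_sum_def ordered_alg_def M(2))
  have le: "nested_le M N a b \<longleftrightarrow> level a \<le> level b"
    if "a \<in> insert z (carrier N)" "b \<in> insert z (carrier N)" for a b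
    using that new z lt[of a] lt[of b] N.E_carrier
    by (auto simp: nested_le_def M.lle_iff_level N.lle_iff_level M.one_eq M(2))
  have mult: "nested_mult M N a b = (if \<bar>level b\<bar> \<le> \<bar>level a\<bar> then a else b)"
    if "a \<in> insert z (carrier N)" "b \<in> insert z (carrier N)" for a b
    using that new z lt[of a] lt[of b] N.E_carrier N.abs_level_inj[of a E] N.abs_level_inj[of b E]
    by (auto simp: nested_mult_def M.mult_eq N.mult_eq M(2))
  have inj: "a = b" if "a \<in> insert z (carrier N)" "b \<in> insert z (carrier N)"
    "\<bar>level a\<bar> = \<bar>level b\<bar>" for a b
    using that lt[of a] lt[of b] N.abs_level_inj[of a b] by auto
  show "level_chain (M \<boxplus> N)"
    by (rule level_chain.intro; (unfold car)?)
      (use N.E_carrier inj in \<open>auto simp: nested_sum_def ordered_alg_def M.one_eq le mult\<close>)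
qed

lemma C2_level_chain: "level_chain (C2 (Suc k))" "carrier (C2 (Suc k)) = {E, Bot (Suc k)}"
proof -
  show "level_chain (C2 (Suc k))" by unfold_locales (auto simp: C2_def ordered_alg_def)
qed (auto simp: C2_def ordered_alg_def)

lemma C2_dual_level_chain:
  "level_chain (C2_dual (Suc k))" "carrier (C2_dual (Suc k)) = {E, Top (Suc k)}"
proof -
  show "level_chain (C2_dual (Suc k))" by unfold_locales (auto simp: C2_dual_def ordered_alg_def)
qed (auto simp: C2_dual_def ordered_alg_def)

lemma abs_level_le: "a \<in> level_elts p n \<Longrightarrow> \<bar>level a\<bar> \<le> int n"
  by (auto simp: level_elts_def)

lemma C_level_chain:
  assumes n: "2 \<le> n"
  shows "level_chain (C n) \<and> carrier (C n) = level_elts (even n) n \<and>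
    level_chain (C_dual n) \<and> carrier (C_dual n) = level_elts (odd n) n"
  using n
proof (induction n rule: nat_induct_at_least)
  case base
  have eqs: "C 2 = C2 2" "C_dual 2 = C2_dual 2" by (simp_all add: numeral_2_eq_2)
  have "level_elts True 2 = {Bot 2, E}" "level_elts False 2 = {E, Top 2}"
    by (auto simp: level_elts_def)
  then show ?case
    unfolding eqs using C2_level_chain[of 1] C2_dual_level_chain[of 1]
    by (auto simp: numeral_2_eq_2)
next
  case (Suc n)
  have eqs: "C (Suc n) = C2 (Suc n) \<boxplus> C_dual n" "C_dual (Suc n) = C2_dual (Suc n) \<boxplus> C n"
    using Suc.hyps by simp_all
  have lt: "\<bar>level a\<bar> < int (Suc n)" if "a \<in> carrier (C n) \<or> a \<in> carrier (C_dual n)" for a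
    using that Suc.IH abs_level_le[of a _ n] by force
  have "insert (Bot (Suc n)) (level_elts (odd n) n) = level_elts (odd n) (Suc n)"
    "insert (Top (Suc n)) (level_elts (even n) n) = level_elts (even n) (Suc n)"
    using Suc.hyps by (auto simp: level_elts_def le_Suc_eq)
  then show ?case
    unfolding eqs using Suc.IH lt
      nested_sum_level_chain[OF C2_level_chain, of "C_dual n" n]
      nested_sum_level_chain[OF C2_dual_level_chain, of "C n" n]
    by (auto simp: abs_level_le)
qed

section \<open>Separating homomorphisms\<close>

context comm_idem_ordered_monoid
begin

definition alternating_below :: "'a \<Rightarrow> nat set" where
  "alternating_below a = {k. \<exists>x. alternating M k x \<and> (0 < k \<longrightarrow> x k \<otimes> a = a)}"

definition depth :: "'a \<Rightarrow> nat" where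
  "depth a = Max (alternating_below a)"

text \<open>
  The element \<open>u\<close> acts as a threshold: whatever does not absorb \<open>u\<close> is collapsed to the identity. The
  other elements are sorted by their depth, whose parity is the side of the identity on which they
  lie; the depth 0 corresponds to the least label 2.
\<close>

definition level_map :: "'a \<Rightarrow> 'a \<Rightarrow> elt" where
  "level_map u a = (if a = \<one> \<or> a \<otimes> u \<noteq> a then E
     else if a \<preceq> \<one> then Bot (depth a + 2) else Top (depth a + 2))"

lemma alternating_carrier: "\<lbrakk>alternating M k x; 0 < k\<rbrakk> \<Longrightarrow> x k \<in> carrier M"
  by (simp add: alternating_def)

context
  fixes n assumes n: "2 \<le> n" and bound: "\<nexists>x. alternating M (n - 1) x"
begin

lemma alternating_below_le: "k \<in> alternating_below a \<Longrightarrow> k \<le> n - 2"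
  using bound alternating_le[of M k _ "n - 1"] by (fastforce simp: alternating_below_def)

lemma finite_alternating_below: "finite (alternating_below a)"
  using alternating_below_le by (rule finite_nat_set_iff_bounded_le[THEN iffD2, OF exI, OF ballI])

lemma depth_mem: "depth a \<in> alternating_below a"
proof -
  have "0 \<in> alternating_below a" by (simp add: alternating_below_def alternating_def)
  then show ?thesis unfolding depth_def using Max_in[OF finite_alternating_below] by blast
qed

lemma depth_le: "depth a \<le> n - 2"
  using alternating_below_le depth_mem .

lemma depth_mono:
  assumes "a \<in> carrier M" "b \<in> carrier M" "a \<otimes> b = b"
  shows "depth a \<le> depth b"
proof -
  have "alternating_below a \<subseteq> alternating_below b"
    using assms absorb_trans alternating_carrier unfolding alternating_below_def by blast
  then show ?thesis
    unfolding depth_def[of b] by (intro Max_ge finite_alternating_below subsetD[OF _ depth_mem])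
qed

text \<open>
  Were the parity wrong, \<open>a\<close> could be appended to a longest alternating sequence below it.
\<close>

lemma depth_parity:
  assumes a: "a \<in> carrier M" "a \<noteq> \<one>"
  shows "a \<preceq> \<one> \<Longrightarrow> even (depth a)" "\<one> \<preceq> a \<Longrightarrow> odd (depth a)"
proof -
  let ?k = "depth a"
  have False if sign: "if even ?k then \<one> \<preceq> a else a \<preceq> \<one>"
  proof -
    obtain x where x: "alternating M ?k x" "0 < ?k \<longrightarrow> x ?k \<otimes> a = a"
      using depth_mem[of a] by (auto simp: alternating_below_def)
    let ?x = "x(Suc ?k := a)"
    have "alternating M (Suc ?k) ?x"
      using x a sign alternating_cong[of ?k ?x x] by (simp add: alternating_Suc)
    then have "Suc ?k \<in> alternating_below a"
      using a by (auto simp: alternating_below_def mult_idem intro!: exI[of _ ?x])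
    then have "Suc ?k \<le> ?k" unfolding depth_def by (rule Max_ge[OF finite_alternating_below])
    then show False by simp
  qed
  then show "a \<preceq> \<one> \<Longrightarrow> even (depth a)" "\<one> \<preceq> a \<Longrightarrow> odd (depth a)"
    by (cases "even ?k"; simp)+
qed

lemma level_map_elts:
  assumes a: "a \<in> carrier M"
  shows "level_map u a \<in> level_elts True n"
  using depth_parity[OF a] depth_le[of a] n not_le[of a \<one>] a
  by (auto simp: level_map_def level_elts_def)

lemma abs_level_map_mono:
  assumes a: "a \<in> carrier M" and b: "b \<in> carrier M" and u: "u \<in> carrier M" and ab: "a \<otimes> b = b"
  shows "\<bar>level (level_map u a)\<bar> \<le> \<bar>level (level_map u b)\<bar>"
proof (cases "a = \<one> \<or> a \<otimes> u \<noteq> a")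
  case True
  then show ?thesis by (simp add: level_map_def)
next
  case False
  then have "b \<otimes> u = b" using absorb_trans[of u a b] a b u ab by (simp add: m_comm)
  moreover have "b \<noteq> \<one>" using ab a False by auto
  ultimately show ?thesis using False depth_mono[OF a b ab] by (simp add: level_map_def)
qed

lemma level_map_sign:
  assumes "a \<in> carrier M"
  shows "a \<preceq> \<one> \<Longrightarrow> level (level_map u a) \<le> 0" "\<one> \<preceq> a \<Longrightarrow> 0 \<le> level (level_map u a)"
  using assms le_antisym[of a \<one>] by (auto simp: level_map_def)

text \<open>
  On the same side of the identity the order agrees with absorption or its converse, so monotonicity
  follows from that of the depth; across the identity only the signs matter.
\<close>

lemma level_map_mono:
  assumes a: "a \<in> carrier M" and b: "b \<in> carrier M" and u: "u \<in> carrier M" and ab: "a \<preceq> b"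
  shows "level (level_map u a) \<le> level (level_map u b)"
proof -
  consider "\<one> \<preceq> a" | "b \<preceq> \<one>" | "a \<preceq> \<one>" "\<one> \<preceq> b" using le_total a b by (meson one_closed)
  then show ?thesis
  proof cases
    case 1
    then have "\<one> \<preceq> b" using le_trans[of \<one> a b] a b ab by simp
    moreover have "a \<otimes> b = b"
      using mult_one_le[OF 1 a b] mult_mono[OF ab le_refl[OF b]] a b le_antisym
      by (simp add: mult_idem)
    ultimately show ?thesis
      using abs_level_map_mono[OF a b u] level_map_sign(2)[OF a 1, of u] level_map_sign(2)[OF b, of u]
      by simp
  next
    case 2
    then have "a \<preceq> \<one>" using le_trans[of a b \<one>] a b ab by simp
    moreover have "b \<otimes> a = a"
      using mult_le_one[OF 2 b a] mult_mono[OF ab le_refl[OF a]] a b le_antisym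
      by (simp add: mult_idem)
    ultimately show ?thesis
      using abs_level_map_mono[OF b a u] level_map_sign(1)[OF b 2, of u] level_map_sign(1)[OF a, of u]
      by simp
  next
    case 3
    then show ?thesis
      using level_map_sign(1)[OF a, of u] level_map_sign(2)[OF b, of u] by linarith
  qed
qed

lemma level_map_hom:
  assumes T: "level_chain T" "carrier T = level_elts True n" and u: "u \<in> carrier M"
  shows "surj_lm_hom (level_map u) M (T\<lparr>carrier := level_map u ` carrier M\<rparr>)"
proof -
  interpret T: level_chain T by (rule T)
  let ?h = "level_map u"
  have mult: "?h (a \<otimes> b) = ?h a \<otimes>\<^bsub>T\<^esub> ?h b" and meet: "?h (a \<curlywedge> b) = ?h a \<curlywedge>\<^bsub>T\<^esub> ?h b"
    and join: "?h (a \<curlyvee> b) = ?h a \<curlyvee>\<^bsub>T\<^esub> ?h b"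
    if a: "a \<in> carrier M" and b: "b \<in> carrier M" for a b
  proof -
    have ha: "?h a \<in> carrier T" and hb: "?h b \<in> carrier T"
      using level_map_elts a b T(2) by auto
    consider "a \<otimes> b = b" | "a \<otimes> b = a" using mult_conservative a b by blast
    then show "?h (a \<otimes> b) = ?h a \<otimes>\<^bsub>T\<^esub> ?h b"
    proof cases
      case 1
      then show ?thesis
        using abs_level_map_mono[OF a b u] T.abs_level_inj[OF ha hb] by (auto simp: T.mult_eq ha hb)
    next
      case 2
      then show ?thesis
        using abs_level_map_mono[OF b a u] m_comm[OF a b] by (auto simp: T.mult_eq ha hb)
    qed
    consider "a \<preceq> b" | "b \<preceq> a" using le_total a b by blast
    then show "?h (a \<curlywedge> b) = ?h a \<curlywedge>\<^bsub>T\<^esub> ?h b" "?h (a \<curlyvee> b) = ?h a \<curlyvee>\<^bsub>T\<^esub> ?h b"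
    proof (atomize(full), cases)
      case 1
      then have "a \<curlywedge> b = a" "a \<curlyvee> b = b" using le_iff_join a b by (auto simp: lle_def)
      then show "?h (a \<curlywedge> b) = ?h a \<curlywedge>\<^bsub>T\<^esub> ?h b \<and> ?h (a \<curlyvee> b) = ?h a \<curlyvee>\<^bsub>T\<^esub> ?h b"
        using level_map_mono[OF a b u 1] by (simp add: T.meet_eq T.join_eq ha hb)
    next
      case 2
      then have "a \<curlywedge> b = b" "a \<curlyvee> b = a"
        using le_iff_join[OF b a] meet_comm[OF a b] join_comm[OF a b] by (auto simp: lle_def)
      then show "?h (a \<curlywedge> b) = ?h a \<curlywedge>\<^bsub>T\<^esub> ?h b \<and> ?h (a \<curlyvee> b) = ?h a \<curlyvee>\<^bsub>T\<^esub> ?h b"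
        using level_map_mono[OF b a u 2] T.level_inj[OF ha hb] by (auto simp: T.meet_eq T.join_eq ha hb)
    qed
  qed
  then show ?thesis by (simp add: surj_lm_hom_def level_map_def[of u \<one>] T.one_eq)
qed

end

text \<open>
  Of two distinct elements one absorbs the other; the absorbing one is the threshold.
\<close>

lemma level_map_separates:
  assumes "p \<in> carrier M" "q \<in> carrier M" "p \<noteq> q"
  shows "\<exists>u \<in> carrier M. level_map u p \<noteq> level_map u q"
proof -
  have sep: "level_map a a \<noteq> level_map a b" if "a \<otimes> b = a" "a \<in> carrier M" "b \<in> carrier M" "a \<noteq> b" for a b
  proof -
    have "a \<noteq> \<one>" using that by auto
    then show ?thesis using that by (auto simp: level_map_def mult_idem m_comm)
  qed
  show ?thesis
    using mult_conservative[OF assms(1,2)] sep[of p q] sep[of q p] assms by (metis m_comm)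
qed

text \<open>
  If \<open>\<sigma> n\<close> holds, the depths are at most \<open>n - 2\<close>, so that the labels do not exceed \<open>n\<close>, and the maps
  \<open>level_map u\<close> are homomorphisms into \<open>T\<close> that jointly separate all elements.
\<close>

lemma in_variety_if_satisfies_sigma:
  assumes n: "2 \<le> n" and sat: "M \<Turnstile> \<sigma> n"
    and T: "level_chain T" "carrier T = level_elts True n"
  shows "M \<in> variety {T}"
proof (rule varietyI[OF lm_algebra_axioms])
  fix q :: "var equation" assume "\<And>A. A \<in> {T} \<Longrightarrow> A \<Turnstile> q"
  then have q: "T \<Turnstile> q" by blast
  have bound: "\<nexists>x. alternating M (n - 1) x" using satisfies_sigma_iff[OF n] sat by blast
  show "M \<Turnstile> q"
    unfolding satisfies_def
  proof (rule ballI, rule ccontr)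
    fix f assume f: "f \<in> UNIV \<rightarrow> carrier M" and neq: "eval M f (fst q) \<noteq> eval M f (snd q)"
    have "eval M f t \<in> carrier M" for t using f lm_algebra_axioms by (auto intro!: eval_closed)
    from level_map_separates[OF this this neq] obtain u where u: "u \<in> carrier M"
      and sep: "level_map u (eval M f (fst q)) \<noteq> level_map u (eval M f (snd q))" by blast
    have "level_map u (eval M f t) = eval T (level_map u \<circ> f) t" for t
      using eval_hom[OF lm_algebra_axioms level_map_hom[OF n bound T u], of t f] f
      by (auto simp: eval_carrier_update)
    moreover have "level_map u \<circ> f \<in> UNIV \<rightarrow> carrier T"
      using f unfolding T(2) by (auto intro!: level_map_elts[OF n bound])
    ultimately show False using q sep by (auto simp: satisfies_def)
  qed
qed

end

section \<open>Duality\<close>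

definition dual_alg :: "'a lmonoid \<Rightarrow> 'a lmonoid" where
  "dual_alg M = M\<lparr>lmeet := ljoin M, ljoin := lmeet M\<rparr>"

definition dual_eqn :: "var equation \<Rightarrow> var equation" where
  "dual_eqn q = (dual (fst q), dual (snd q))"

lemma dual_alg_simps [simp]:
  "carrier (dual_alg M) = carrier M" "\<one>\<^bsub>dual_alg M\<^esub> = \<one>\<^bsub>M\<^esub>"
  "a \<otimes>\<^bsub>dual_alg M\<^esub> b = a \<otimes>\<^bsub>M\<^esub> b"
  "a \<curlywedge>\<^bsub>dual_alg M\<^esub> b = a \<curlyvee>\<^bsub>M\<^esub> b" "a \<curlyvee>\<^bsub>dual_alg M\<^esub> b = a \<curlywedge>\<^bsub>M\<^esub> b"
  by (simp_all add: dual_alg_def)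

lemma dual_alg_dual_alg [simp]: "dual_alg (dual_alg M) = M"
  by (simp add: dual_alg_def)

lemma dual_dual [simp]: "dual (dual t) = t"
  by (induction t) (auto split: var.split)

lemma dual_eqn_dual_eqn [simp]: "dual_eqn (dual_eqn q) = q"
  by (simp add: dual_eqn_def)

definition swap_var :: "var \<Rightarrow> var" where
  "swap_var v = (case v of X k \<Rightarrow> Y k | Y k \<Rightarrow> X k)"

lemma swap_var_swap_var [simp]: "swap_var (swap_var v) = v"
  by (simp add: swap_var_def split: var.split)

lemma eval_dual: "eval M f (dual t) = eval (dual_alg M) (f \<circ> swap_var) t"
  by (induction t) (auto simp: swap_var_def)

lemma dual_alg_satisfies_iff:
  fixes M :: "'a lmonoid"
  shows "dual_alg M \<Turnstile> q \<longleftrightarrow> M \<Turnstile> dual_eqn q"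
proof
  assume L: "dual_alg M \<Turnstile> q"
  show "M \<Turnstile> dual_eqn q"
    unfolding satisfies_def
  proof
    fix f :: "var \<Rightarrow> 'a" assume "f \<in> UNIV \<rightarrow> carrier M"
    then have "f \<circ> swap_var \<in> UNIV \<rightarrow> carrier (dual_alg M)" by auto
    then show "eval M f (fst (dual_eqn q)) = eval M f (snd (dual_eqn q))"
      using L by (simp add: satisfies_def dual_eqn_def eval_dual)
  qed
next
  assume R: "M \<Turnstile> dual_eqn q"
  show "dual_alg M \<Turnstile> q"
    unfolding satisfies_def
  proof
    fix f :: "var \<Rightarrow> 'a" assume "f \<in> UNIV \<rightarrow> carrier (dual_alg M)"
    then have "f \<circ> swap_var \<in> UNIV \<rightarrow> carrier M" by auto
    moreover have "f \<circ> swap_var \<circ> swap_var = f" by auto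
    ultimately show "eval (dual_alg M) f (fst q) = eval (dual_alg M) f (snd q)"
      using R by (fastforce simp: satisfies_def dual_eqn_def eval_dual)
  qed
qed

lemma dual_alg_CIdDLM: "M \<in> CIdDLM \<Longrightarrow> dual_alg M \<in> CIdDLM"
proof -
  assume "M \<in> CIdDLM"
  then interpret comm_idem_dist_lmonoid M by (simp add: CIdDLM_def)
  have "comm_idem_dist_lmonoid (dual_alg M)"
    by (unfold_locales, simp_all add: meet_assoc join_assoc meet_absorb join_absorb
        join_meet_distrib mult_join_distrib mult_meet_distrib mult_idem)
      (auto intro: m_assoc m_comm meet_comm join_comm)
  then show ?thesis by (simp add: CIdDLM_def)
qed

lemma satisfies_sigma_dual_iff:
  assumes "M \<in> CIdDLM"
  shows "M \<Turnstile> \<sigma>_dual n \<longleftrightarrow> dual_alg M \<Turnstile> \<sigma> n"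
proof -
  interpret comm_idem_dist_lmonoid M using assms by (simp add: CIdDLM_def)
  have "eval M f (dual (t_trm n)) \<preceq> eval M f (dual (s_trm n)) \<longleftrightarrow>
      eval M f (dual (s_trm n)) \<curlyvee>\<^bsub>M\<^esub> eval M f (dual (t_trm n)) = eval M f (dual (s_trm n))"
    if "f \<in> UNIV \<rightarrow> carrier M" for f
  proof -
    have car: "eval M f t \<in> carrier M" for t using that lm_algebra_axioms by (auto intro!: eval_closed)
    show ?thesis using le_iff_join[OF car car] join_comm[OF car car] by metis
  qed
  then show ?thesis
    unfolding dual_alg_satisfies_iff
    by (simp add: satisfies_def \<sigma>_dual_def \<sigma>_def dual_eqn_def leq_eqn_def lle_def)
qed

primrec swap_elt :: "elt \<Rightarrow> elt" where
  "swap_elt E = E"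
| "swap_elt (Bot k) = Top k"
| "swap_elt (Top k) = Bot k"

lemma level_swap_elt [simp]: "level (swap_elt a) = - level a"
  by (cases a) auto

lemma swap_elt_swap_elt [simp]: "swap_elt (swap_elt a) = a"
  by (cases a) auto

lemma swap_elt_level_elts: "swap_elt ` level_elts p n = level_elts (\<not> p) n"
proof -
  have sub: "swap_elt ` level_elts p n \<subseteq> level_elts (\<not> p) n" for p
    by (auto simp: level_elts_def)
  have "x \<in> swap_elt ` level_elts p n" if "x \<in> level_elts (\<not> p) n" for x
    using that sub[of "\<not> p"] by (intro image_eqI[of _ _ "swap_elt x"]) auto
  then show ?thesis using sub[of p] by blast
qed

text \<open>
  Negating the level makes \<open>C n\<close> and \<open>C_dual n\<close> dual to each other.
\<close>

lemma swap_elt_hom: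
  assumes A: "level_chain A" "carrier A = level_elts p n"
    and B: "level_chain B" "carrier B = level_elts (\<not> p) n"
  shows "surj_lm_hom swap_elt (dual_alg A) B"
proof -
  interpret A: level_chain A by (rule A)
  interpret B: level_chain B by (rule B)
  have im: "swap_elt ` carrier A = carrier B" using A(2) B(2) swap_elt_level_elts by simp
  then have B_mem: "a \<in> carrier A \<Longrightarrow> swap_elt a \<in> carrier B" for a by blast
  have "swap_elt (a \<curlyvee>\<^bsub>A\<^esub> b) = swap_elt a \<curlywedge>\<^bsub>B\<^esub> swap_elt b \<and>
      swap_elt (a \<curlywedge>\<^bsub>A\<^esub> b) = swap_elt a \<curlyvee>\<^bsub>B\<^esub> swap_elt b"
    if "a \<in> carrier A" "b \<in> carrier A" for a b
  proof (cases "level a" "level b" rule: linorder_cases)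
    case equal
    then have "a = b" using A.level_inj that by blast
    then show ?thesis using that by (simp add: A.meet_eq A.join_eq B.meet_eq B.join_eq B_mem)
  qed (use that in \<open>simp_all add: A.meet_eq A.join_eq B.meet_eq B.join_eq B_mem\<close>)
  then show ?thesis
    using im by (simp add: surj_lm_hom_def A.one_eq B.one_eq A.mult_eq B.mult_eq B_mem)
qed

lemma satisfies_dual_eqn_iff:
  assumes A: "level_chain A" "carrier A = level_elts p n"
    and B: "level_chain B" "carrier B = level_elts (\<not> p) n"
  shows "B \<Turnstile> q \<longleftrightarrow> A \<Turnstile> dual_eqn q"
proof -
  have "dual_alg A \<in> CIdDLM" "dual_alg B \<in> CIdDLM"
    using level_chain.CIdDLM A(1) B(1) dual_alg_CIdDLM by auto
  note alg = this[THEN CIdDLM_lm_algebra]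
  have "surj_lm_hom swap_elt (dual_alg B) A" using swap_elt_hom[OF B A(1)] A(2) by simp
  from satisfies_hom_image[OF alg(2) this, of "dual_eqn q"]
    and satisfies_hom_image[OF alg(1) swap_elt_hom[OF A B], of q]
  show ?thesis unfolding dual_alg_satisfies_iff dual_eqn_dual_eqn by blast
qed

lemma in_variety_dual_iff:
  fixes M :: "'a lmonoid"
  assumes A: "level_chain A" "carrier A = level_elts p n"
    and B: "level_chain B" "carrier B = level_elts (\<not> p) n"
    and M: "M \<in> CIdDLM"
  shows "M \<in> variety {B} \<longleftrightarrow> dual_alg M \<in> variety {A}"
proof -
  note alg = CIdDLM_lm_algebra[OF M] CIdDLM_lm_algebra[OF dual_alg_CIdDLM[OF M]]
  note sat = satisfies_dual_eqn_iff[OF A B] dual_alg_satisfies_iff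
  show ?thesis
  proof
    assume "M \<in> variety {B}"
    from varietyD[OF this] show "dual_alg M \<in> variety {A}"
      by (intro varietyI[OF alg(2)]) (simp add: sat)
  next
    assume "dual_alg M \<in> variety {A}"
    from varietyD[OF this] have *: "A \<Turnstile> q \<Longrightarrow> M \<Turnstile> dual_eqn q" for q by (simp add: sat)
    show "M \<in> variety {B}"
      using *[of "dual_eqn _"] by (intro varietyI[OF alg(1)]) (simp add: sat)
  qed
qed

section \<open>Axiomatizations\<close>

text \<open>
  In the algebra with even labels below the identity, an alternating sequence begins at label 3 or
  higher, so it has fewer than \<open>n - 1\<close> entries.
\<close>

lemma axiomatizes_sigma:
  assumes n: "2 \<le> n" and T: "level_chain T" "carrier T = level_elts True n"
  shows "axiomatizes_rel (\<sigma> n) (variety {T}) (CIdDLM :: 'a lmonoid set)"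
proof (rule axiomatizes_relI)
  interpret T: level_chain T by (rule T)
  show "{T} \<subseteq> CIdDLM" using T.CIdDLM by simp
  have "\<not> alternating T (n - 1) x" for x
  proof
    assume alt: "alternating T (n - 1) x"
    obtain k where k: "n - 1 = Suc k" using n by (cases "n - 1") auto
    have x1: "x 1 \<in> carrier T" "x 1 \<noteq> E" "0 \<le> level (x 1)" and xk: "x (Suc k) \<in> carrier T"
      using alt k T.E_carrier by (auto simp: alternating_def T.one_eq T.lle_iff_level)
    have "3 \<le> k" if "2 \<le> k" "odd k" for k :: nat using that by presburger
    then have "3 \<le> \<bar>level (x 1)\<bar>" using x1 by (auto simp: T(2) level_elts_def)
    moreover have "\<bar>level (x (Suc k))\<bar> \<le> int n" using xk abs_level_le T(2) by metis
    ultimately show False using T.alternating_level[of k x] alt k by simp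
  qed
  then show "A \<in> {T} \<Longrightarrow> A \<Turnstile> \<sigma> n" for A using T.satisfies_sigma_iff[OF n] by auto
next
  fix Q :: "'a set lmonoid"
  assume "comm_idem_ordered_monoid Q" "Q \<Turnstile> \<sigma> n"
  then show "Q \<in> variety {T}"
    using comm_idem_ordered_monoid.in_variety_if_satisfies_sigma n T by blast
qed

lemma axiomatizes_sigma_dual:
  assumes n: "2 \<le> n" and T: "level_chain T" "carrier T = level_elts False n"
    and T': "level_chain T'" "carrier T' = level_elts True n"
  shows "axiomatizes_rel (\<sigma>_dual n) (variety {T}) (CIdDLM :: 'a lmonoid set)"
proof -
  have sub: "variety {T} \<subseteq> CIdDLM"
    using variety_subset_CIdDLM[of "{T}"] level_chain.CIdDLM[OF T(1)] by simp
  have "M \<in> variety {T} \<longleftrightarrow> M \<Turnstile> \<sigma>_dual n" if M: "M \<in> CIdDLM" for M :: "'a lmonoid"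
  proof -
    have "M \<in> variety {T} \<longleftrightarrow> dual_alg M \<in> variety {T'}"
      using in_variety_dual_iff[OF T' _ _ M] T by simp
    also have "\<dots> \<longleftrightarrow> dual_alg M \<Turnstile> \<sigma> n"
      using axiomatizes_sigma[OF n T'] dual_alg_CIdDLM[OF M] by (auto simp: axiomatizes_rel_def)
    finally show ?thesis using satisfies_sigma_dual_iff[OF M] by simp
  qed
  then show ?thesis using sub by (auto simp: axiomatizes_rel_def)
qed

lemma satisfies_sigma_Suc:
  assumes A: "level_chain A" "carrier A = level_elts p n" and n: "2 \<le> n"
  shows "A \<Turnstile> \<sigma> (Suc n)"
proof -
  interpret A: level_chain A by (rule A)
  have "\<not> alternating A n x" for x
  proof
    assume alt: "alternating A n x"
    obtain k where k: "n = Suc k" using n by (cases n) auto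
    have x1: "x 1 \<in> carrier A" "x 1 \<noteq> E" and xk: "x (Suc k) \<in> carrier A"
      using alt k by (auto simp: alternating_def A.one_eq)
    then have "2 \<le> \<bar>level (x 1)\<bar>" by (auto simp: A(2) level_elts_def)
    moreover have "\<bar>level (x (Suc k))\<bar> \<le> int n" using xk abs_level_le A(2) by metis
    ultimately show False using A.alternating_level[of k x] alt k by simp
  qed
  then show ?thesis using A.satisfies_sigma_iff[of "Suc n"] n by auto
qed

lemma satisfies_sigma_dual_Suc:
  assumes A: "level_chain A" "carrier A = level_elts p n"
    and B: "level_chain B" "carrier B = level_elts (\<not> p) n" and n: "2 \<le> n"
  shows "A \<Turnstile> \<sigma>_dual (Suc n)"
  unfolding satisfies_sigma_dual_iff[OF level_chain.CIdDLM[OF A(1)]] dual_alg_satisfies_iff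
    satisfies_dual_eqn_iff[OF A B, symmetric]
  by (rule satisfies_sigma_Suc[OF B n])

lemma s_trm_t_trm_one:
  assumes "comm_idem_dist_lmonoid M" "\<And>k. f (X k) = \<one>\<^bsub>M\<^esub>"
  shows "eval M f (s_trm n) = \<one>\<^bsub>M\<^esub> \<and> eval M f (t_trm n) = \<one>\<^bsub>M\<^esub>"
proof -
  interpret comm_idem_dist_lmonoid M by (rule assms)
  show ?thesis
    by (induction n) (use assms(2) le_refl[of "\<one>\<^bsub>M\<^esub>"] in \<open>auto simp: meet_idem le_iff_join\<close>)
qed

lemma vars_s_trm_t_trm: "vars (s_trm n) \<subseteq> range X" "vars (t_trm n) \<subseteq> range X"
  by (induction n) auto

text \<open>
  The two sides of \<open>\<gamma>\<close> are products of those of \<open>\<sigma>\<close> and \<open>\<sigma>_dual\<close>, which share no variables. Setting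
  the variables of one of the two to the identity makes both its sides the identity and leaves
  the other equation.
\<close>

lemma satisfies_gamma_iff:
  assumes M: "M \<in> CIdDLM"
  shows "M \<Turnstile> \<gamma> n \<longleftrightarrow> M \<Turnstile> \<sigma> n \<and> M \<Turnstile> \<sigma>_dual n"
proof -
  interpret comm_idem_dist_lmonoid M using M by (simp add: CIdDLM_def)
  have D: "comm_idem_dist_lmonoid (dual_alg M)" using dual_alg_CIdDLM[OF M] by (simp add: CIdDLM_def)
  let ?s = "\<lambda>f. eval M f (s_trm n)" and ?t = "\<lambda>f. eval M f (t_trm n)"
    and ?s' = "\<lambda>f. eval M f (dual (s_trm n))" and ?t' = "\<lambda>f. eval M f (dual (t_trm n))"
  have car: "eval M f u \<in> carrier M" if "f \<in> UNIV \<rightarrow> carrier M" for f and u :: "var trm"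
    using that lm_algebra_axioms by (auto intro!: eval_closed)
  have \<sigma>: "M \<Turnstile> \<sigma> n \<longleftrightarrow> (\<forall>f \<in> UNIV \<rightarrow> carrier M. ?s f \<preceq> ?t f)"
    and \<sigma>_dual: "M \<Turnstile> \<sigma>_dual n \<longleftrightarrow> (\<forall>f \<in> UNIV \<rightarrow> carrier M. ?t' f \<preceq> ?s' f)"
    and \<gamma>: "M \<Turnstile> \<gamma> n \<longleftrightarrow> (\<forall>f \<in> UNIV \<rightarrow> carrier M. ?s f \<otimes>\<^bsub>M\<^esub> ?t' f \<preceq> ?t f \<otimes>\<^bsub>M\<^esub> ?s' f)"
    by (simp_all add: satisfies_def \<sigma>_def \<sigma>_dual_def \<gamma>_def leq_eqn_def lle_def)
  show ?thesis
  proof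
    assume "M \<Turnstile> \<gamma> n"
    then have le: "?s f \<otimes>\<^bsub>M\<^esub> ?t' f \<preceq> ?t f \<otimes>\<^bsub>M\<^esub> ?s' f" if "f \<in> UNIV \<rightarrow> carrier M" for f
      using \<gamma> that by blast
    have "?s f \<preceq> ?t f" if f: "f \<in> UNIV \<rightarrow> carrier M" for f
    proof -
      define g where "g = (\<lambda>v. case v of X k \<Rightarrow> f v | Y k \<Rightarrow> \<one>\<^bsub>M\<^esub>)"
      have g: "g \<in> UNIV \<rightarrow> carrier M" using f by (auto simp: g_def split: var.split)
      have "?s g = ?s f" "?t g = ?t f"
        using vars_s_trm_t_trm[of n] by (auto intro!: eval_cong simp: g_def)
      moreover have "?s' g = \<one>\<^bsub>M\<^esub>" "?t' g = \<one>\<^bsub>M\<^esub>"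
        using s_trm_t_trm_one[OF D, of "g \<circ> swap_var" n]
        by (simp_all add: eval_dual g_def swap_var_def)
      ultimately show ?thesis using le[OF g] car[OF f] by simp
    qed
    moreover have "?t' f \<preceq> ?s' f" if f: "f \<in> UNIV \<rightarrow> carrier M" for f
    proof -
      define g where "g = (\<lambda>v. case v of X k \<Rightarrow> \<one>\<^bsub>M\<^esub> | Y k \<Rightarrow> f v)"
      have g: "g \<in> UNIV \<rightarrow> carrier M" using f by (auto simp: g_def split: var.split)
      have "?s' g = ?s' f" "?t' g = ?t' f"
        unfolding eval_dual using vars_s_trm_t_trm[of n]
        by (auto intro!: eval_cong simp: g_def swap_var_def)
      moreover have "?s g = \<one>\<^bsub>M\<^esub>" "?t g = \<one>\<^bsub>M\<^esub>"
        using s_trm_t_trm_one[OF comm_idem_dist_lmonoid_axioms, of g n] by (simp_all add: g_def)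
      ultimately show ?thesis using le[OF g] car[OF f] by simp
    qed
    ultimately show "M \<Turnstile> \<sigma> n \<and> M \<Turnstile> \<sigma>_dual n" using \<sigma> \<sigma>_dual by blast
  next
    assume "M \<Turnstile> \<sigma> n \<and> M \<Turnstile> \<sigma>_dual n"
    then show "M \<Turnstile> \<gamma> n" using \<sigma> \<sigma>_dual \<gamma> mult_mono car by metis
  qed
qed

lemma (in comm_idem_ordered_monoid) dual_alg_ordered: "comm_idem_ordered_monoid (dual_alg M)"
proof (intro comm_idem_ordered_monoid.intro comm_idem_ordered_monoid_axioms.intro)
  show "comm_idem_dist_lmonoid (dual_alg M)"
    using dual_alg_CIdDLM[of M] comm_idem_dist_lmonoid_axioms by (simp add: CIdDLM_def)
  show "lle (dual_alg M) a b \<or> lle (dual_alg M) b a"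
    if "a \<in> carrier (dual_alg M)" "b \<in> carrier (dual_alg M)" for a b
    using that le_total[of a b] by (simp add: le_iff_join) (auto simp: lle_def join_comm)
qed

context comm_idem_ordered_monoid
begin

lemma lle_dual_alg: "\<lbrakk>a \<in> carrier M; b \<in> carrier M\<rbrakk> \<Longrightarrow> lle (dual_alg M) a b \<longleftrightarrow> b \<preceq> a"
  using le_iff_join[of b a] join_comm[of a b] by (simp add: lle_def)

text \<open>
  Reversing the order turns sequences beginning above the identity into sequences beginning below
  it, so a suitable first entry can be put in front.
\<close>

lemma alternating_prepend:
  assumes y: "alternating (dual_alg M) k y"
    and z: "z \<in> carrier M" "z \<noteq> \<one>" "\<one> \<preceq> z" "z \<otimes> y 1 = y 1"
  shows "alternating M (Suc k) (\<lambda>i. if i = 1 then z else y (i - 1))"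
proof -
  have "y i \<in> carrier M \<and> y i \<noteq> \<one> \<and> (if odd i then y i \<preceq> \<one> else \<one> \<preceq> y i)"
    if "1 \<le> i" "i \<le> k" for i
    using y that lle_dual_alg[of \<one> "y i"] lle_dual_alg[of "y i" \<one>]
    by (auto simp: alternating_def)
  then have sign: "y (i - 1) \<in> carrier M \<and> y (i - 1) \<noteq> \<one> \<and>
      (if even i then y (i - 1) \<preceq> \<one> else \<one> \<preceq> y (i - 1))"
    if "1 \<le> i" "i \<noteq> 1" "i \<le> Suc k" for i
    using that by (cases i) auto
  have absorb: "y (i - 1) \<otimes> y i = y i" if "1 \<le> i" "i \<noteq> 1" "i < Suc k" for i
    using that y by (cases i) (auto simp: alternating_def)
  let ?x = "\<lambda>i. if i = 1 then z else y (i - 1)"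
  have "?x i \<in> carrier M \<and> ?x i \<noteq> \<one> \<and> (if odd i then \<one> \<preceq> ?x i else ?x i \<preceq> \<one>)"
    if "1 \<le> i" "i \<le> Suc k" for i
    using z sign[of i] that by (cases "i = 1"; cases "even i") auto
  moreover have "?x i \<otimes> ?x (Suc i) = ?x (Suc i)" if "1 \<le> i" "i < Suc k" for i
    using z absorb[of i] that by (cases "i = 1") auto
  ultimately show ?thesis unfolding alternating_def by blast
qed

text \<open>
  If both equations failed, there would be two alternating sequences of length \<open>n - 1\<close>, one beginning
  above and one below the identity. One of the two first entries absorbs the other, so one of the
  sequences can be lengthened, which contradicts \<open>\<sigma> (Suc n)\<close> or its dual.
\<close>

lemma satisfies_sigma_or_sigma_dual:
  assumes n: "2 \<le> n" and s: "M \<Turnstile> \<sigma> (Suc n)" and d: "M \<Turnstile> \<sigma>_dual (Suc n)"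
  shows "M \<Turnstile> \<sigma> n \<or> M \<Turnstile> \<sigma>_dual n"
proof (rule ccontr)
  have M: "M \<in> CIdDLM" by (simp add: CIdDLM_def comm_idem_dist_lmonoid_axioms)
  assume "\<not> (M \<Turnstile> \<sigma> n \<or> M \<Turnstile> \<sigma>_dual n)"
  then obtain x y where x: "alternating M (n - 1) x" and y: "alternating (dual_alg M) (n - 1) y"
    using satisfies_sigma_iff[OF n] comm_idem_ordered_monoid.satisfies_sigma_iff[OF dual_alg_ordered n] satisfies_sigma_dual_iff[OF M] by blast
  have x1: "x 1 \<in> carrier M" "x 1 \<noteq> \<one>" "\<one> \<preceq> x 1"
    using x n by (auto simp: alternating_def)
  have y1: "y 1 \<in> carrier M" "y 1 \<noteq> \<one>" "lle (dual_alg M) \<one> (y 1)"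
    using y n by (auto simp: alternating_def)
  have "\<nexists>w. alternating M n w" "\<nexists>w. alternating (dual_alg M) n w"
    using satisfies_sigma_iff[of "Suc n"] comm_idem_ordered_monoid.satisfies_sigma_iff[OF dual_alg_ordered, of "Suc n"]
      satisfies_sigma_dual_iff[OF M] n s d by auto
  moreover have "Suc (n - 1) = n" using n by simp
  moreover consider "x 1 \<otimes> y 1 = y 1" | "x 1 \<otimes> y 1 = x 1" using mult_conservative x1 y1 by blast
  ultimately show False
    using alternating_prepend[OF y x1] comm_idem_ordered_monoid.alternating_prepend[OF dual_alg_ordered, of "n - 1" x "y 1"] x x1 y1 m_comm[of "x 1" "y 1"]
    by (cases; simp; metis)
qed

end

lemma axiomatizes_gamma:
  assumes n: "2 \<le> n" and A: "level_chain A" "carrier A = level_elts True n"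
    and B: "level_chain B" "carrier B = level_elts False n"
  shows "axiomatizes_rel (\<gamma> (Suc n)) (variety {A, B}) (CIdDLM :: 'a lmonoid set)"
proof (rule axiomatizes_relI)
  have AB: "A \<in> CIdDLM" "B \<in> CIdDLM" using level_chain.CIdDLM A(1) B(1) by auto
  then show "{A, B} \<subseteq> CIdDLM" by simp
  have "A \<Turnstile> \<sigma> (Suc n)" "B \<Turnstile> \<sigma> (Suc n)" using satisfies_sigma_Suc A B n by auto
  moreover have "A \<Turnstile> \<sigma>_dual (Suc n)" "B \<Turnstile> \<sigma>_dual (Suc n)"
    using satisfies_sigma_dual_Suc[OF A _ _ n, of B] satisfies_sigma_dual_Suc[OF B _ _ n, of A] A B
    by simp_all
  ultimately show "X \<in> {A, B} \<Longrightarrow> X \<Turnstile> \<gamma> (Suc n)" for X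
    using satisfies_gamma_iff AB by blast
next
  fix Q :: "'a set lmonoid"
  assume "comm_idem_ordered_monoid Q" and sat: "Q \<Turnstile> \<gamma> (Suc n)"
  then interpret comm_idem_ordered_monoid Q by simp
  have Q: "Q \<in> CIdDLM" by (simp add: CIdDLM_def comm_idem_dist_lmonoid_axioms)
  have "Q \<Turnstile> \<sigma> n \<or> Q \<Turnstile> \<sigma>_dual n"
    using satisfies_sigma_or_sigma_dual[OF n] sat satisfies_gamma_iff[OF Q] by blast
  then have "Q \<in> variety {A} \<or> Q \<in> variety {B}"
    using axiomatizes_sigma[OF n A, where ?'a = "'a set"]
      axiomatizes_sigma_dual[OF n B A, where ?'a = "'a set"] Q
    unfolding axiomatizes_rel_def by blast
  then show "Q \<in> variety {A, B}" using variety_mono[of "{A}" "{A, B}"] variety_mono[of "{B}" "{A, B}"] by blast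
qed

theorem theorem6p10:
  fixes n :: nat
  assumes "n \<ge> 2"
  shows "(even n \<longrightarrow>
            axiomatizes_rel (\<sigma> n) (variety {C n}) (CIdDLM :: 'a lmonoid set) \<and>
            axiomatizes_rel (\<sigma>_dual n) (variety {C_dual n}) (CIdDLM :: 'a lmonoid set)) \<and>
         (odd n \<longrightarrow>
            axiomatizes_rel (\<sigma> n) (variety {C_dual n}) (CIdDLM :: 'a lmonoid set) \<and>
            axiomatizes_rel (\<sigma>_dual n) (variety {C n}) (CIdDLM :: 'a lmonoid set)) \<and>
         axiomatizes_rel (\<gamma> (n + 1)) (variety {C n, C_dual n}) (CIdDLM :: 'a lmonoid set)"
proof (cases "even n")
  case True
  then have "level_chain (C n)" "carrier (C n) = level_elts True n"
    "level_chain (C_dual n)" "carrier (C_dual n) = level_elts False n"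
    using C_level_chain[OF assms] by auto
  then show ?thesis
    using True axiomatizes_sigma axiomatizes_sigma_dual axiomatizes_gamma[of n "C n" "C_dual n"] assms
    by auto
next
  case False
  then have "level_chain (C n)" "carrier (C n) = level_elts False n"
    "level_chain (C_dual n)" "carrier (C_dual n) = level_elts True n"
    using C_level_chain[OF assms] by auto
  then show ?thesis
    using False axiomatizes_sigma axiomatizes_sigma_dual axiomatizes_gamma[of n "C_dual n" "C n"] assms
    by (auto simp: insert_commute)
qed

end
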